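(* Let $S$ be a translation surface in Euclidean space $\mathbb{R}^3$ that is of linear Weingarten type, i.e. there exist real numbers $a,b,c$, not all zero, such that the mean curvature $H$ and the Gauss curvature $K$ of $S$ satisfy $aH+bK=c$ on $S$. Then $K$ is constant on $S$ or $H$ is constant on $S$. In particular, $S$ is (locally) congruent with a plane, a generalized cylinder or a Scherk's minimal surface; that is, each point of $S$ has a neighborhood in $S$ which is carried by a rigid motion of $\mathbb{R}^3$ onto an open part of one of these surfaces.
   Context: Surfaces are smooth. A surface $S$ in $\mathbb{R}^3$ is a translation surface if it can be locally parametrized, in Cartesian coordinates $(x,y,z)$ fixed for $S$, as $X(x,y)=(x,y,f(x)+g(y))$, where $f:I\to\mathbb{R}$ and $g:J\to\mathbb{R}$ are smooth functions on open intervals $I,J\subset\mathbb{R}$. If $\{E,F,G\}$ and $\{e,\mathsf{f},\mathsf{g}\}$ denote the coefficients of the first and second fundamental forms of a local parametrization, then $$H=\frac{eG-2\mathsf{f}F+\mathsf{g}E}{2(EG-F^2)},\qquad K=\frac{e\mathsf{g}-\mathsf{f}^2}{EG-F^2}.$$ For $X(x,y)=(x,y,f(x)+g(y))$, with the upward unit normal, this gives $$H=\frac{f''(1+g'^2)+g''(1+f'^2)}{2(1+f'^2+g'^2)^{3/2}},\qquad K=\frac{f''g''}{(1+f'^2+g'^2)^2}.$$ A generalized cylinder is a surface formed by parallel straight lines through the points of a planar curve (the lines being transverse to the plane of the curve). A Scherk's minimal surface is the surface $z=\frac{1}{\lambda}\left(\log(\cos(\lambda y))-\log(\cos(\lambda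 x))\right)$ for some $\lambda>0$. *)

theory Defs
  imports "HOL-Analysis.Analysis"
begin

text \<open>Class \<open>C\<^sup>k\<close> and \<open>C\<^sup>\<infinity>\<close>, meaningful for open sets \<open>U\<close> only.\<close>

primrec C_k_on :: "nat \<Rightarrow> 'a::euclidean_space set \<Rightarrow> ('a \<Rightarrow> 'b::real_normed_vector) \<Rightarrow> bool" where
  "C_k_on 0 U f \<longleftrightarrow> continuous_on U f"
| "C_k_on (Suc k) U f \<longleftrightarrow>
     (\<forall>x\<in>U. f differentiable at x) \<and> (\<forall>v. C_k_on k U (\<lambda>x. frechet_derivative f (at x) v))"

definition smooth_on :: "'a::euclidean_space set \<Rightarrow> ('a \<Rightarrow> 'b::real_normed_vector) \<Rightarrow> bool" where
  "smooth_on U f \<longleftrightarrow> (\<forall>k. C_k_on k U f)"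

definition Du :: "(real \<times> real \<Rightarrow> real^3) \<Rightarrow> real \<times> real \<Rightarrow> real^3" where
  "Du X q = frechet_derivative X (at q) (1, 0)"

definition Dv :: "(real \<times> real \<Rightarrow> real^3) \<Rightarrow> real \<times> real \<Rightarrow> real^3" where
  "Dv X q = frechet_derivative X (at q) (0, 1)"

definition local_parametrization ::
    "(real^3) set \<Rightarrow> (real \<times> real) set \<Rightarrow> (real \<times> real \<Rightarrow> real^3) \<Rightarrow> bool" where
  "local_parametrization S U X \<longleftrightarrow>
     open U \<and> smooth_on U X \<and> openin (top_of_set S) (X ` U) \<and>
     (\<exists>Y. homeomorphism U (X ` U) X Y) \<and>
     (\<forall>q\<in>U. inj (frechet_derivative X (at q)))"

definition smooth_surface :: "(real^3) set \<Rightarrow> bool" where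
  "smooth_surface S \<longleftrightarrow> (\<forall>p\<in>S. \<exists>U X. local_parametrization S U X \<and> p \<in> X ` U)"

definition fff_E :: "(real \<times> real \<Rightarrow> real^3) \<Rightarrow> real \<times> real \<Rightarrow> real" where
  "fff_E X q = Du X q \<bullet> Du X q"

definition fff_F :: "(real \<times> real \<Rightarrow> real^3) \<Rightarrow> real \<times> real \<Rightarrow> real" where
  "fff_F X q = Du X q \<bullet> Dv X q"

definition fff_G :: "(real \<times> real \<Rightarrow> real^3) \<Rightarrow> real \<times> real \<Rightarrow> real" where
  "fff_G X q = Dv X q \<bullet> Dv X q"

text \<open>In the second fundamental form, \<open>n\<close> is the unit normal vector chosen at the point \<open>X q\<close>.\<close>

definition sff_e :: "(real \<times> real \<Rightarrow> real^3) \<Rightarrow> real^3 \<Rightarrow> real \<times> real \<Rightarrow> real" where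
  "sff_e X n q = Du (Du X) q \<bullet> n"

definition sff_f :: "(real \<times> real \<Rightarrow> real^3) \<Rightarrow> real^3 \<Rightarrow> real \<times> real \<Rightarrow> real" where
  "sff_f X n q = Dv (Du X) q \<bullet> n"

definition sff_g :: "(real \<times> real \<Rightarrow> real^3) \<Rightarrow> real^3 \<Rightarrow> real \<times> real \<Rightarrow> real" where
  "sff_g X n q = Dv (Dv X) q \<bullet> n"

definition mean_curvature_param ::
    "(real \<times> real \<Rightarrow> real^3) \<Rightarrow> real^3 \<Rightarrow> real \<times> real \<Rightarrow> real" where
  "mean_curvature_param X n q =
     (sff_e X n q * fff_G X q - 2 * sff_f X n q * fff_F X q + sff_g X n q * fff_E X q) /
     (2 * (fff_E X q * fff_G X q - (fff_F X q)\<^sup>2))"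

definition gauss_curvature_param ::
    "(real \<times> real \<Rightarrow> real^3) \<Rightarrow> real^3 \<Rightarrow> real \<times> real \<Rightarrow> real" where
  "gauss_curvature_param X n q =
     (sff_e X n q * sff_g X n q - (sff_f X n q)\<^sup>2) /
     (fff_E X q * fff_G X q - (fff_F X q)\<^sup>2)"

definition unit_normal_field :: "(real^3) set \<Rightarrow> (real^3 \<Rightarrow> real^3) \<Rightarrow> bool" where
  "unit_normal_field S N \<longleftrightarrow>
     continuous_on S N \<and> (\<forall>p\<in>S. norm (N p) = 1) \<and>
     (\<forall>U X. local_parametrization S U X \<longrightarrow>
        (\<forall>q\<in>U. orthogonal (N (X q)) (Du X q) \<and> orthogonal (N (X q)) (Dv X q)))"

text \<open>Both curvatures at a point do not depend on the local parametrization in which they are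
  computed, so the descriptions below are proper. Reversing \<open>N\<close> changes the sign of the mean
  curvature and does not affect the Gauss curvature.\<close>

definition mean_curvature :: "(real^3) set \<Rightarrow> (real^3 \<Rightarrow> real^3) \<Rightarrow> real^3 \<Rightarrow> real" where
  "mean_curvature S N p =
     (THE h. \<exists>U X q. local_parametrization S U X \<and> q \<in> U \<and> X q = p \<and>
                     h = mean_curvature_param X (N p) q)"

definition gauss_curvature :: "(real^3) set \<Rightarrow> (real^3 \<Rightarrow> real^3) \<Rightarrow> real^3 \<Rightarrow> real" where
  "gauss_curvature S N p =
     (THE k. \<exists>U X q. local_parametrization S U X \<and> q \<in> U \<and> X q = p \<and>
                     k = gauss_curvature_param X (N p) q)"

definition linear_weingarten :: "(real^3) set \<Rightarrow> (real^3 \<Rightarrow> real^3) \<Rightarrow> bool" where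
  "linear_weingarten S N \<longleftrightarrow>
     (\<exists>a b c :: real. \<not> (a = 0 \<and> b = 0 \<and> c = 0) \<and>
        (\<forall>p\<in>S. a * mean_curvature S N p + b * gauss_curvature S N p = c))"

text \<open>The pair \<open>A\<close>, \<open>t\<close> is the system of Cartesian coordinates fixed for the surface: the point with
  coordinates \<open>(x, y, z)\<close> is \<open>A *v vector [x, y, z] + t\<close>.\<close>

definition translation_patch ::
    "real^3^3 \<Rightarrow> real^3 \<Rightarrow> (real \<Rightarrow> real) \<Rightarrow> (real \<Rightarrow> real) \<Rightarrow> real \<times> real \<Rightarrow> real^3" where
  "translation_patch A t f g = (\<lambda>(x, y). A *v vector [x, y, f x + g y] + t)"

definition translation_surface :: "(real^3) set \<Rightarrow> bool" where
  "translation_surface S \<longleftrightarrow>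
     smooth_surface S \<and>
     (\<exists>A t. orthogonal_matrix A \<and>
        (\<forall>p\<in>S. \<exists>I J f g.
           open I \<and> is_interval I \<and> open J \<and> is_interval J \<and> smooth_on I f \<and> smooth_on J g \<and>
           local_parametrization S (I \<times> J) (translation_patch A t f g) \<and>
           p \<in> translation_patch A t f g ` (I \<times> J)))"

definition is_plane :: "(real^3) set \<Rightarrow> bool" where
  "is_plane M \<longleftrightarrow> affine M \<and> aff_dim M = 2"

text \<open>A generalized cylinder has a regular directrix \<open>\<gamma>\<close> in the plane \<open>n \<bullet> x = d\<close> and rulings in
  a direction \<open>w\<close> transverse to that plane.\<close>

definition generalized_cylinder :: "(real^3) set \<Rightarrow> bool" where
  "generalized_cylinder M \<longleftrightarrow>
     smooth_surface M \<and>
     (\<exists>(n :: real^3) d w I (\<gamma> :: real \<Rightarrow> real^3).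
        open I \<and> is_interval I \<and> I \<noteq> {} \<and> smooth_on I \<gamma> \<and>
        (\<forall>s\<in>I. vector_derivative \<gamma> (at s) \<noteq> 0) \<and>
        (\<forall>s\<in>I. n \<bullet> \<gamma> s = d) \<and> n \<bullet> w \<noteq> 0 \<and>
        M = {\<gamma> s + r *\<^sub>R w | s r. s \<in> I})"

definition scherk_surface :: "real \<Rightarrow> (real^3) set" where
  "scherk_surface l =
     {vector [x, y, (1 / l) * (ln (cos (l * y)) - ln (cos (l * x)))] | x y.
        cos (l * x) > 0 \<and> cos (l * y) > 0}"

definition rigid_motion :: "(real^3 \<Rightarrow> real^3) \<Rightarrow> bool" where
  "rigid_motion T \<longleftrightarrow> (\<exists>A t. rotation_matrix A \<and> T = (\<lambda>x. A *v x + t))"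

definition locally_congruent_at :: "(real^3) set \<Rightarrow> real^3 \<Rightarrow> (real^3) set \<Rightarrow> bool" where
  "locally_congruent_at S p M \<longleftrightarrow>
     (\<exists>V T. openin (top_of_set S) V \<and> p \<in> V \<and> rigid_motion T \<and> openin (top_of_set M) (T ` V))"

end

theory Submission
  imports Defs "HOL-Computational_Algebra.Polynomial"
begin

text \<open>Put \<open>p = f'\<close>, \<open>q = g'\<close>, \<open>u = f''\<close>, \<open>v = g''\<close> and \<open>W\<^sup>2 = 1 + p\<^sup>2 + q\<^sup>2\<close>. The Weingarten relation reads
  \<open>\<alpha> W (u (1 + q\<^sup>2) + v (1 + p\<^sup>2)) + b u v = c W\<^sup>4\<close> with \<open>\<alpha> = \<plusminus> a / 2\<close>, and it is linear in \<open>v\<close>. Writing it at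
  two points \<open>x\<^sub>1\<close>, \<open>x\<^sub>2\<close> with \<open>p\<^sub>1\<^sup>2 \<noteq> p\<^sub>2\<^sup>2\<close> and eliminating \<open>v\<close> gives a relation between \<open>1\<close>, \<open>W\<^sub>1\<close>, \<open>W\<^sub>2\<close>,
  \<open>W\<^sub>1 W\<^sub>2\<close> whose coefficients are polynomials in \<open>t = q\<^sup>2\<close>. Since \<open>W\<^sub>i\<close> is the square root of
  \<open>t + 1 + p\<^sub>i\<^sup>2\<close>, these four functions are linearly independent over the polynomials, and where \<open>u v \<noteq> 0\<close>
  the vanishing of the coefficients forces \<open>b = c = 0\<close>. Hence either \<open>b = c = 0\<close> and \<open>H = 0\<close>, or \<open>u v = 0\<close>,
  that is \<open>K = 0\<close>, everywhere. In the second case one of \<open>f\<close>, \<open>g\<close> is affine on each patch, which therefore is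
  part of a cylinder (a plane, if its directrix is straight). In the first case separation of variables yields \<open>u = m (1 + p\<^sup>2)\<close> and
  \<open>v = - m (1 + q\<^sup>2)\<close>, whose solutions are affine for \<open>m = 0\<close> and logarithms of cosines otherwise.\<close>

subsection \<open>Square roots over the real polynomials\<close>

lemma poly_eq_0_if_infinite_zeros:
  fixes p :: "real poly"
  assumes "infinite T" "\<And>t. t \<in> T \<Longrightarrow> poly p t = 0"
  shows "p = 0"
proof (rule ccontr)
  assume "p \<noteq> 0"
  then have "finite {t. poly p t = 0}" by (rule poly_roots_finite)
  moreover have "T \<subseteq> {t. poly p t = 0}" using assms(2) by blast
  ultimately show False using assms(1) finite_subset by blast
qed

text \<open>Multiplicities at \<open>x\<close> are compared: both squares contribute an even order,
  \<open>r\<close> an odd one, so the two sides cannot be nonzero.\<close>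

lemma square_eq_odd_order_times_square:
  fixes p q r :: "real poly"
  assumes eq: "p\<^sup>2 = r * q\<^sup>2" and r: "r \<noteq> 0" and odd: "odd (order x r)"
  shows "p = 0" "q = 0"
proof -
  show "q = 0"
  proof (rule ccontr)
    assume q: "q \<noteq> 0"
    then have p: "p \<noteq> 0" using eq r by auto
    have "2 * order x p = order x (p\<^sup>2)"
      using p by (simp add: power2_eq_square order_mult)
    also have "\<dots> = order x r + 2 * order x q"
      using q r unfolding eq by (simp add: power2_eq_square order_mult)
    finally show False using odd by presburger
  qed
  then show "p = 0" using eq by simp
qed

lemma order_linear: "order x [:s, 1:] = (if x = - s then 1 else 0)" for x s :: real
proof (cases "x = - s")
  case True
  then show ?thesis using order_power_n_n[of x 1] by simp
next
  case False
  then show ?thesis by (auto intro!: order_0I)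
qed

text \<open>Squaring gives \<open>P^2 = (t + s) Q^2\<close> at infinitely many points, hence as
  polynomials, and \<open>t + s\<close> has a simple root at \<open>- s\<close>.\<close>

lemma sqrt_independent_over_poly:
  fixes P Q :: "real poly"
  assumes "infinite T"
    and "\<And>t. t \<in> T \<Longrightarrow> 0 \<le> t + s"
    and "\<And>t. t \<in> T \<Longrightarrow> poly P t + poly Q t * sqrt (t + s) = 0"
  shows "P = 0" "Q = 0"
proof -
  have "P\<^sup>2 - [:s, 1:] * Q\<^sup>2 = 0"
  proof (rule poly_eq_0_if_infinite_zeros[OF assms(1)])
    fix t assume t: "t \<in> T"
    have "poly P t = - (poly Q t * sqrt (t + s))" using assms(3)[OF t] by simp
    then have "(poly P t)\<^sup>2 = (poly Q t)\<^sup>2 * (t + s)"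
      using assms(2)[OF t] by (simp add: power_mult_distrib)
    then show "poly (P\<^sup>2 - [:s, 1:] * Q\<^sup>2) t = 0" by (simp add: algebra_simps)
  qed
  then have eq: "P\<^sup>2 = [:s, 1:] * Q\<^sup>2" by simp
  have "odd (order (- s) [:s, 1:])" by (simp add: order_linear)
  from square_eq_odd_order_times_square[OF eq _ this] show "P = 0" "Q = 0" by simp_all
qed

text \<open>The square roots are removed one at a time: isolating the terms with
  \<open>sqrt (t + s2)\<close> and squaring leaves a relation in \<open>sqrt (t + s1)\<close> alone,
  to which the previous lemma applies.\<close>

lemma two_sqrts_independent_over_poly:
  fixes P0 P1 P2 P3 :: "real poly"
  assumes "infinite T" and s: "s1 \<noteq> s2"
    and nn: "\<And>t. t \<in> T \<Longrightarrow> 0 \<le> t + s1" "\<And>t. t \<in> T \<Longrightarrow> 0 \<le> t + s2"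
    and zero: "\<And>t. t \<in> T \<Longrightarrow> poly P0 t + poly P1 t * sqrt (t + s1) + poly P2 t * sqrt (t + s2)
            + poly P3 t * sqrt (t + s1) * sqrt (t + s2) = 0"
  shows "P0 = 0" "P1 = 0" "P2 = 0" "P3 = 0"
proof -
  define L1 L2 where "L1 = [:s1, 1:]" and "L2 = [:s2, 1:]"
  have L: "L1 \<noteq> 0" "L2 \<noteq> 0" "L1 * L2 \<noteq> 0"
    by (simp_all add: L1_def L2_def)
  have dbl: "2 * p = 2 * q \<Longrightarrow> p = q" for p q :: "real poly" by simp
  \<comment> \<open>With \<open>W1^2 = L1\<close> and \<open>W2^2 = L2\<close>, these are the part
    free of \<open>W1\<close> and the coefficient of \<open>W1\<close> in
    \<open>(P0 + P1 W1)^2 - L2 (P2 + P3 W1)^2\<close>.\<close>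
  let ?R0 = "P0\<^sup>2 + L1 * P1\<^sup>2 - L2 * (P2\<^sup>2 + L1 * P3\<^sup>2)"
  let ?R1 = "2 * (P0 * P1 - L2 * (P2 * P3))"
  have eq: "poly ?R0 t + poly ?R1 t * sqrt (t + s1) = 0" if t: "t \<in> T" for t
  proof -
    define w1 w2 where "w1 = sqrt (t + s1)" and "w2 = sqrt (t + s2)"
    have w: "t + s1 = w1\<^sup>2" "t + s2 = w2\<^sup>2" using nn[OF t] by (simp_all add: w1_def w2_def)
    have "poly P0 t + poly P1 t * w1 = - (w2 * (poly P2 t + poly P3 t * w1))"
      using zero[OF t] unfolding w1_def[symmetric] w2_def[symmetric] by (simp add: algebra_simps)
    then have "(poly P0 t + poly P1 t * w1)\<^sup>2 = w2\<^sup>2 * (poly P2 t + poly P3 t * w1)\<^sup>2"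
      by (simp add: power_mult_distrib)
    moreover have "poly L1 t = w1\<^sup>2" "poly L2 t = w2\<^sup>2" using w by (simp_all add: L1_def L2_def)
    ultimately show ?thesis
      unfolding w1_def[symmetric] poly_add poly_diff poly_mult poly_power poly_numeral
      by algebra
  qed
  have R: "?R0 = 0" "?R1 = 0"
    using sqrt_independent_over_poly[OF assms(1) nn(1) eq] by blast+
  have h0: "P0\<^sup>2 + L1 * P1\<^sup>2 = L2 * (P2\<^sup>2 + L1 * P3\<^sup>2)" using R(1) by (simp only: right_minus_eq)
  have "P0 * P1 - L2 * (P2 * P3) = 0" using R(2) by (metis mult_eq_0_iff zero_neq_numeral)
  then have h1: "P0 * P1 = L2 * (P2 * P3)" by (simp only: right_minus_eq)
  \<comment> \<open>Equality of the norms of both sides of \<open>P0 + P1 W1 = - W2 (P2 + P3 W1)\<close> over the field generated by \<open>W1\<close>\<close>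
  have "(P0\<^sup>2 - L1 * P1\<^sup>2)\<^sup>2 = (L2 * (P2\<^sup>2 - L1 * P3\<^sup>2))\<^sup>2"
    using h0 h1 by algebra
  \<comment> \<open>For either sign, the sum and the difference with \<open>h0\<close> isolate the
    four squares in pairs, and each pair has the shape treated by the parity lemma.\<close>
  then consider "P0\<^sup>2 - L1 * P1\<^sup>2 = L2 * (P2\<^sup>2 - L1 * P3\<^sup>2)"
    | "P0\<^sup>2 - L1 * P1\<^sup>2 = - (L2 * (P2\<^sup>2 - L1 * P3\<^sup>2))"
    using power2_eq_iff by blast
  then have "P0 = 0 \<and> P1 = 0 \<and> P2 = 0 \<and> P3 = 0"
  proof cases
    case 1
    have "2 * P0\<^sup>2 = 2 * (L2 * P2\<^sup>2)" using 1 h0 by algebra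
    then have e0: "P0\<^sup>2 = L2 * P2\<^sup>2" by (rule dbl)
    have "L1 * (2 * P1\<^sup>2) = L1 * (2 * (L2 * P3\<^sup>2))" using 1 h0 by algebra
    then have "2 * P1\<^sup>2 = 2 * (L2 * P3\<^sup>2)" using L(1) mult_left_cancel by blast
    then have e1: "P1\<^sup>2 = L2 * P3\<^sup>2" by (rule dbl)
    have "odd (order (- s2) L2)" by (simp add: L2_def order_linear)
    then show ?thesis
      using square_eq_odd_order_times_square[OF e0 L(2)]
        square_eq_odd_order_times_square[OF e1 L(2)] by blast
  next
    case 2
    have "2 * P0\<^sup>2 = 2 * (L1 * L2 * P3\<^sup>2)" using 2 h0 by algebra
    then have e0: "P0\<^sup>2 = L1 * L2 * P3\<^sup>2" by (rule dbl)
    \<comment> \<open>The difference reads \<open>L1 P1^2 = L2 P2^2\<close>; a further factor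
      \<open>L1\<close> turns the left side into a square.\<close>
    have "2 * (L1 * P1)\<^sup>2 = 2 * (L1 * L2 * P2\<^sup>2)" using 2 h0 by algebra
    then have e1: "(L1 * P1)\<^sup>2 = L1 * L2 * P2\<^sup>2" by (rule dbl)
    \<comment> \<open>As \<open>s1\<close> and \<open>s2\<close> differ, \<open>L1\<close> does not
      vanish at \<open>- s2\<close>, so the root of the product there is simple.\<close>
    have "order (- s2) (L1 * L2) = 1"
      unfolding order_mult[OF L(3)] using s by (simp add: L1_def L2_def order_linear)
    then have od: "odd (order (- s2) (L1 * L2))" by simp
    show ?thesis
      using square_eq_odd_order_times_square[OF e0 L(3) od]
        square_eq_odd_order_times_square[OF e1 L(3) od] L(1)
      by simp
  qed
  then show "P0 = 0" "P1 = 0" "P2 = 0" "P3 = 0" by simp_all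
qed

text \<open>Here \<open>t\<close> stands for \<open>q^2\<close>, \<open>s1\<close> and
  \<open>s2\<close> for \<open>1 + p^2\<close> at two points, \<open>u1\<close> and
  \<open>u2\<close> for \<open>f''\<close> there, and \<open>v\<close> for \<open>g''\<close>. Only
  \<open>t\<close> and \<open>v\<close> vary, so eliminating \<open>v\<close> leaves a relation
  whose coefficients are polynomials in \<open>t\<close>.\<close>

lemma weingarten_elimination:
  fixes \<alpha> b c s1 s2 u1 u2 :: real
  assumes T: "infinite T" "\<And>t. t \<in> T \<Longrightarrow> 0 \<le> t"
    and s: "0 < s1" "0 < s2" "s1 \<noteq> s2" and u: "u1 \<noteq> 0" "u2 \<noteq> 0"
    and nz: "\<not> (\<alpha> = 0 \<and> b = 0 \<and> c = 0)"
    and eq: "\<And>t. t \<in> T \<Longrightarrow> \<exists>v. v \<noteq> 0 \<and>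
       \<alpha> * sqrt (t + s1) * (u1 * (1 + t) + v * s1) + b * u1 * v = c * (t + s1)\<^sup>2 \<and>
       \<alpha> * sqrt (t + s2) * (u2 * (1 + t) + v * s2) + b * u2 * v = c * (t + s2)\<^sup>2"
  shows "b = 0 \<and> c = 0"
proof -
  \<comment> \<open>Writing the two equations as \<open>v D1 = N1\<close> and
    \<open>v D2 = N2\<close>, these are the coefficients of \<open>1\<close>, \<open>W1\<close>,
    \<open>W2\<close> and \<open>W1 W2\<close> in \<open>N1 D2 - N2 D1\<close>.\<close>
  let ?P0 = "smult (c * b) (smult u2 ([:s1, 1:]\<^sup>2) - smult u1 ([:s2, 1:]\<^sup>2))"
  let ?P1 = "smult (- \<alpha>) (smult (b * u1 * u2) [:1, 1:] + smult (c * s1) ([:s2, 1:]\<^sup>2))"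
  let ?P2 = "smult \<alpha> (smult (c * s2) ([:s1, 1:]\<^sup>2) + smult (b * u1 * u2) [:1, 1:])"
  let ?P3 = "smult (\<alpha>\<^sup>2 * (u2 * s1 - u1 * s2)) [:1, 1:]"
  have zero: "poly ?P0 t + poly ?P1 t * sqrt (t + s1) + poly ?P2 t * sqrt (t + s2)
      + poly ?P3 t * sqrt (t + s1) * sqrt (t + s2) = 0" if t: "t \<in> T" for t
  proof -
    define w1 w2 where "w1 = sqrt (t + s1)" and "w2 = sqrt (t + s2)"
    have w: "t + s1 = w1\<^sup>2" "t + s2 = w2\<^sup>2" using T(2)[OF t] s by (simp_all add: w1_def w2_def)
    obtain v where v: "\<alpha> * w1 * (u1 * (1 + t) + v * s1) + b * u1 * v = c * (t + s1)\<^sup>2"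
        "\<alpha> * w2 * (u2 * (1 + t) + v * s2) + b * u2 * v = c * (t + s2)\<^sup>2"
      using eq[OF t] unfolding w1_def w2_def by blast
    \<comment> \<open>Both sides equal \<open>v D1 D2\<close>; no division takes place, so
      \<open>D1\<close> and \<open>D2\<close> may vanish.\<close>
    have cross: "v * D1 = N1 \<Longrightarrow> v * D2 = N2 \<Longrightarrow> N1 * D2 = N2 * D1" for D1 D2 N1 N2 by auto
    have "v * (\<alpha> * w1 * s1 + b * u1) = c * (t + s1)\<^sup>2 - \<alpha> * w1 * u1 * (1 + t)"
      "v * (\<alpha> * w2 * s2 + b * u2) = c * (t + s2)\<^sup>2 - \<alpha> * w2 * u2 * (1 + t)"
      using v by (simp_all add: algebra_simps)
    then have "(c * (t + s1)\<^sup>2 - \<alpha> * w1 * u1 * (1 + t)) * (\<alpha> * w2 * s2 + b * u2)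
       = (c * (t + s2)\<^sup>2 - \<alpha> * w2 * u2 * (1 + t)) * (\<alpha> * w1 * s1 + b * u1)"
      by (rule cross)
    moreover have "poly [:s1, 1:] t = t + s1" "poly [:s2, 1:] t = t + s2" "poly [:1, 1:] t = 1 + t"
      by simp_all
    ultimately show ?thesis
      unfolding w1_def[symmetric] w2_def[symmetric]
        poly_add poly_diff poly_mult poly_power poly_smult by algebra
  qed
  have nn: "0 \<le> t + s1" "0 \<le> t + s2" if "t \<in> T" for t using T(2)[OF that] s by simp_all
  note P = two_sqrts_independent_over_poly[OF T(1) s(3) nn zero]
  have P0: "c * b * (u2 * (t + s1)\<^sup>2 - u1 * (t + s2)\<^sup>2) = 0" for t
    using arg_cong[OF P(1), of "\<lambda>p. poly p t"] by (simp add: add.commute)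
  have P2: "\<alpha> * (c * s2 * (t + s1)\<^sup>2 + b * u1 * u2 * (1 + t)) = 0" for t
    using arg_cong[OF P(3), of "\<lambda>p. poly p t"] by (simp add: algebra_simps)
  show ?thesis
  proof (cases "\<alpha> = 0")
    case False
    have A: "c * s2 * (t + s1)\<^sup>2 + b * u1 * u2 * (1 + t) = 0" for t using P2[of t] False by simp
    \<comment> \<open>The second difference over 0, 1, 2 kills the affine term and leaves twice the
      leading coefficient.\<close>
    have "2 * (c * s2) = 0" using A[of 0] A[of 1] A[of 2] by algebra
    then have "c * s2 = 0" by simp
    moreover have "b * u1 * u2 = 0" using A[of 0] \<open>c * s2 = 0\<close> by simp
    ultimately show ?thesis using s u by simp
  next
    case True
    \<comment> \<open>For \<alpha> = 0 the relation is \<open>b u1 v = c (t + s1)^2\<close> with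
      \<open>u1\<close>, \<open>v\<close> and \<open>t + s1\<close> nonzero. Hence \<open>b\<close>
      and \<open>c\<close> could only vanish together, which \<open>nz\<close> excludes, and this
      case ends in a contradiction.\<close>
    obtain t where t: "t \<in> T" using T(1) by fastforce
    obtain v where "v \<noteq> 0" "b * u1 * v = c * (t + s1)\<^sup>2" using eq[OF t] True by auto
    moreover have "(t + s1)\<^sup>2 > 0" using T(2)[OF t] s by simp
    ultimately have bc: "b \<noteq> 0" "c \<noteq> 0" using nz True u by auto
    have A: "u2 * (t + s1)\<^sup>2 - u1 * (t + s2)\<^sup>2 = 0" for t using P0[of t] bc by simp
    \<comment> \<open>\<open>A\<close> is an identity of polynomials, so it may be evaluated at the
      negative number \<open>- s2\<close>, where the term with \<open>u1\<close> disappears.\<close>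
    have "u2 * (s1 - s2)\<^sup>2 = 0" using A[of "- s2"] by (simp add: algebra_simps)
    then show ?thesis using s u by simp
  qed
qed

subsection \<open>Smooth functions\<close>

text \<open>On an open set the derivative depends only on the values there. Since
  \<open>frechet_derivative\<close> follows the usual rules only at points of differentiability, the
  closure under sums and compositions below is reduced to this lemma.\<close>

lemma C_k_on_cong:
  assumes "open U" "\<And>x. x \<in> U \<Longrightarrow> f x = g x" "C_k_on k U f"
  shows "C_k_on k U g"
  using assms(2,3)
proof (induction k arbitrary: f g)
  case 0
  then show ?case by (metis C_k_on.simps(1) continuous_on_cong)
next
  case (Suc k)
  have d: "(g has_derivative frechet_derivative f (at x)) (at x)" if "x \<in> U" for x
  proof (rule has_derivative_transform_within_open[OF _ assms(1) that])
    show "(f has_derivative frechet_derivative f (at x)) (at x)"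
      using Suc.prems(2) that by (auto simp flip: frechet_derivative_works)
  qed (use Suc.prems(1) in simp)
  have "C_k_on k U (\<lambda>x. frechet_derivative g (at x) v)" for v
  proof (rule Suc.IH)
    show "C_k_on k U (\<lambda>x. frechet_derivative f (at x) v)" using Suc.prems(2) by simp
  next
    fix x assume "x \<in> U"
    show "frechet_derivative f (at x) v = frechet_derivative g (at x) v"
      using frechet_derivative_at[OF d[OF \<open>x \<in> U\<close>]] by simp
  qed
  then show ?case using differentiableI[OF d] by simp
qed

lemma C_k_on_const: "C_k_on k U (\<lambda>x. c)"
proof (induction k arbitrary: c)
  case (Suc k)
  have "frechet_derivative (\<lambda>x. c) (at x) = (\<lambda>v. 0)" for x :: 'a
    using frechet_derivative_const by auto
  then show ?case using Suc[of 0] by simp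
qed simp

lemma C_k_on_bounded_linear:
  assumes "bounded_linear L"
  shows "C_k_on k U L"
proof (cases k)
  case 0
  then show ?thesis using assms by (simp add: linear_continuous_on)
next
  case (Suc n)
  have "frechet_derivative L (at x) = L" for x
    using frechet_derivative_at[OF bounded_linear_imp_has_derivative[OF assms]] by metis
  then show ?thesis
    using Suc assms by (simp add: C_k_on_const bounded_linear_imp_differentiable)
qed

lemma C_k_on_add:
  assumes "open U" "C_k_on k U f" "C_k_on k U g"
  shows "C_k_on k U (\<lambda>x. f x + g x)"
  using assms(2,3)
proof (induction k arbitrary: f g)
  case 0
  then show ?case by (simp add: continuous_on_add)
next
  case (Suc k)
  have "C_k_on k U (\<lambda>x. frechet_derivative (\<lambda>x. f x + g x) (at x) v)" for v
  proof (rule C_k_on_cong[OF assms(1)])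
    show "C_k_on k U (\<lambda>x. frechet_derivative f (at x) v + frechet_derivative g (at x) v)"
      by (rule Suc.IH) (use Suc.prems in simp_all)
  next
    fix x assume "x \<in> U"
    then have "((\<lambda>x. f x + g x) has_derivative
        (\<lambda>v. frechet_derivative f (at x) v + frechet_derivative g (at x) v)) (at x)"
      using Suc.prems by (auto intro!: derivative_eq_intros simp flip: frechet_derivative_works)
    then show "frechet_derivative f (at x) v + frechet_derivative g (at x) v =
        frechet_derivative (\<lambda>x. f x + g x) (at x) v"
      by (metis frechet_derivative_at)
  qed
  then show ?case using Suc.prems by simp
qed

lemma C_k_on_bounded_linear_compose:
  assumes "open U" "bounded_linear L" "C_k_on k U f"
  shows "C_k_on k U (\<lambda>x. L (f x))"
  using assms(3)
proof (induction k arbitrary: f)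
  case 0
  then show ?case using assms(2) bounded_linear.continuous_on by auto
next
  case (Suc k)
  have d: "((\<lambda>x. L (f x)) has_derivative (\<lambda>v. L (frechet_derivative f (at x) v))) (at x)"
    if "x \<in> U" for x
    using Suc.prems that by (auto intro!: bounded_linear.has_derivative[OF assms(2)] simp flip: frechet_derivative_works)
  have "C_k_on k U (\<lambda>x. frechet_derivative (\<lambda>x. L (f x)) (at x) v)" for v
  proof (rule C_k_on_cong[OF assms(1)])
    show "C_k_on k U (\<lambda>x. L (frechet_derivative f (at x) v))"
      by (rule Suc.IH) (use Suc.prems in simp_all)
  next
    fix x assume "x \<in> U"
    show "L (frechet_derivative f (at x) v) = frechet_derivative (\<lambda>x. L (f x)) (at x) v"
      using frechet_derivative_at[OF d[OF \<open>x \<in> U\<close>]] by metis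
  qed
  then show ?case using differentiableI[OF d] by simp
qed

lemma C_k_on_compose_bounded_linear:
  assumes "open U" "bounded_linear L" "C_k_on k W f" "\<And>x. x \<in> U \<Longrightarrow> L x \<in> W"
  shows "C_k_on k U (\<lambda>x. f (L x))"
  using assms(3)
proof (induction k arbitrary: f)
  case 0
  then have "continuous_on W f" by simp
  then show ?case using continuous_on_compose2[OF _ linear_continuous_on[OF assms(2)]] assms(4)
    by (metis C_k_on.simps(1) image_subsetI)
next
  case (Suc k)
  have d: "((\<lambda>x. f (L x)) has_derivative (\<lambda>v. frechet_derivative f (at (L x)) (L v))) (at x)"
    if "x \<in> U" for x
  proof (rule has_derivative_compose[OF bounded_linear_imp_has_derivative[OF assms(2)]])
    show "(f has_derivative frechet_derivative f (at (L x))) (at (L x))"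
      using Suc.prems assms(4)[OF that] by (auto simp flip: frechet_derivative_works)
  qed
  have "C_k_on k U (\<lambda>x. frechet_derivative (\<lambda>x. f (L x)) (at x) v)" for v
  proof (rule C_k_on_cong[OF assms(1)])
    show "C_k_on k U (\<lambda>x. frechet_derivative f (at (L x)) (L v))"
      by (rule Suc.IH[where f="\<lambda>y. frechet_derivative f (at y) (L v)"]) (use Suc.prems in simp_all)
  next
    fix x assume "x \<in> U"
    show "frechet_derivative f (at (L x)) (L v) = frechet_derivative (\<lambda>x. f (L x)) (at x) v"
      using frechet_derivative_at[OF d[OF \<open>x \<in> U\<close>]] by metis
  qed
  then show ?case using differentiableI[OF d] by simp
qed

lemma frechet_derivative_real:
  fixes f :: "real \<Rightarrow> real"
  assumes "f differentiable at x"
  shows "(f has_real_derivative frechet_derivative f (at x) 1) (at x)"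
proof -
  have d: "(f has_derivative frechet_derivative f (at x)) (at x)"
    using assms by (simp add: frechet_derivative_works)
  have "frechet_derivative f (at x) v = frechet_derivative f (at x) 1 * v" for v
    using linear_scale[OF has_derivative_linear[OF d], of v 1] by (simp add: mult.commute)
  then have eq: "frechet_derivative f (at x) = (*) (frechet_derivative f (at x) 1)" by (rule ext)
  show ?thesis unfolding has_field_derivative_def by (rule has_derivative_eq_rhs[OF d eq])
qed

lemma smooth_on_real_second_derivative:
  fixes f :: "real \<Rightarrow> real"
  assumes "smooth_on I f"
  obtains f1 f2 where
    "\<And>x. x \<in> I \<Longrightarrow> (f has_real_derivative f1 x) (at x)"
    "\<And>x. x \<in> I \<Longrightarrow> (f1 has_real_derivative f2 x) (at x)"
    "continuous_on I f2"
proof -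
  define f1 where "f1 = (\<lambda>x. frechet_derivative f (at x) 1)"
  define f2 where "f2 = (\<lambda>x. frechet_derivative f1 (at x) 1)"
  have "C_k_on (Suc (Suc 0)) I f" using assms unfolding smooth_on_def by blast
  then have *: "\<forall>x\<in>I. f differentiable at x" "C_k_on (Suc 0) I f1"
    unfolding f1_def C_k_on.simps(2)[of "Suc 0"] by blast+
  then have "\<forall>x\<in>I. f1 differentiable at x" "continuous_on I f2"
    unfolding f2_def by simp_all
  then show thesis
    using that[of f1 f2] * frechet_derivative_real unfolding f1_def f2_def by blast
qed

section \<open>Vanishing of \<open>f'' g''\<close> unless \<open>b = c = 0\<close>\<close>

lemma infinite_square_image:
  fixes h h' :: "real \<Rightarrow> real"
  assumes K: "open K" "connected K" "K \<noteq> {}"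
    and h: "\<And>x. x \<in> K \<Longrightarrow> (h has_real_derivative h' x) (at x)"
    and nz: "\<And>x. x \<in> K \<Longrightarrow> h' x \<noteq> 0"
  shows "infinite ((\<lambda>x. (h x)\<^sup>2) ` K)"
proof
  let ?g = "\<lambda>x. (h x)\<^sup>2"
  assume fin: "finite (?g ` K)"
  have "continuous_on K h"
    using h DERIV_isCont continuous_at_imp_continuous_on by blast
  then have "connected (?g ` K)"
    by (intro connected_continuous_image K continuous_intros)
  \<comment> \<open>A finite connected nonempty set is a single point, so \<open>h^2\<close> is
    constant; then \<open>2 h h' = 0\<close> forces \<open>h = 0\<close> and with it
    \<open>h' = 0\<close>.\<close>
  then obtain C where C: "\<And>x. x \<in> K \<Longrightarrow> ?g x = C"
    using connected_finite_iff_sing[of "?g ` K"] fin K(3) by auto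
  have const_deriv: "D = 0" if "(k has_real_derivative D) (at x)" "x \<in> K" "\<And>y. y \<in> K \<Longrightarrow> k y = c"
    for k D x c
  proof -
    have "(k has_real_derivative 0) (at x)"
      by (rule has_field_derivative_transform_within_open[OF DERIV_const K(1) that(2)])
        (simp add: that(3))
    then show ?thesis using that(1) DERIV_unique by blast
  qed
  have h0: "h x = 0" if x: "x \<in> K" for x
  proof -
    have "(?g has_real_derivative 2 * h x * h' x) (at x)"
      using h[OF x] by (auto intro!: derivative_eq_intros)
    then have "2 * h x * h' x = 0" using const_deriv x C by blast
    then show ?thesis using nz[OF x] by simp
  qed
  obtain x where "x \<in> K" using K by blast
  then show False using const_deriv[OF h] h0 nz by blast
qed

text \<open>If the product is nonzero at one point, continuity keeps both factors nonzero on small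
  intervals. There \<open>p^2\<close> takes two distinct values and \<open>q^2\<close> infinitely
  many, so the elimination yields \<open>b = c = 0\<close>.\<close>

lemma weingarten_dichotomy:
  fixes f1 f2 g1 g2 :: "real \<Rightarrow> real"
  assumes I: "open I" and J: "open J"
    and f: "\<And>x. x \<in> I \<Longrightarrow> (f1 has_real_derivative f2 x) (at x)" "continuous_on I f2"
    and g: "\<And>y. y \<in> J \<Longrightarrow> (g1 has_real_derivative g2 y) (at y)" "continuous_on J g2"
    and nz: "\<not> (\<alpha> = 0 \<and> b = 0 \<and> c = 0)" "\<not> (b = 0 \<and> c = 0)"
    and eq: "\<And>x y. x \<in> I \<Longrightarrow> y \<in> J \<Longrightarrow>
       \<alpha> * sqrt (1 + (f1 x)\<^sup>2 + (g1 y)\<^sup>2) * (f2 x * (1 + (g1 y)\<^sup>2) + g2 y * (1 + (f1 x)\<^sup>2))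
         + b * f2 x * g2 y = c * (1 + (f1 x)\<^sup>2 + (g1 y)\<^sup>2)\<^sup>2"
    and x: "x \<in> I" and y: "y \<in> J"
  shows "f2 x * g2 y = 0"
proof (rule ccontr)
  assume "f2 x * g2 y \<noteq> 0"
  then have n: "f2 x \<noteq> 0" "g2 y \<noteq> 0" by auto
  have ball: "\<exists>e>0. ball z e \<subseteq> K \<and> (\<forall>w\<in>ball z e. k w \<noteq> 0)"
    if "open K" "continuous_on K k" "z \<in> K" "k z \<noteq> 0" for K z and k :: "real \<Rightarrow> real"
  proof -
    have "open (K \<inter> k -` (- {0}))"
      by (rule continuous_open_preimage[OF that(2,1)]) (rule open_Compl, simp)
    moreover have "z \<in> K \<inter> k -` (- {0})" using that by simp
    ultimately obtain e where "e > 0" "ball z e \<subseteq> K \<inter> k -` (- {0})"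
      using open_contains_ball by blast
    then show ?thesis by blast
  qed
  obtain d e where d: "d > 0" "ball x d \<subseteq> I" "\<And>w. w \<in> ball x d \<Longrightarrow> f2 w \<noteq> 0"
    and e: "e > 0" "ball y e \<subseteq> J" "\<And>w. w \<in> ball y e \<Longrightarrow> g2 w \<noteq> 0"
    using ball[OF I f(2) x n(1)] ball[OF J g(2) y n(2)] by metis
  have "infinite ((\<lambda>x. (f1 x)\<^sup>2) ` ball x d)"
    by (rule infinite_square_image[where h'=f2]) (use d f in auto)
  then have "\<not> (\<lambda>x. (f1 x)\<^sup>2) ` ball x d \<subseteq> {(f1 x)\<^sup>2}"
    using finite_subset by blast
  then obtain x1 x2 where x12: "x1 \<in> ball x d" "x2 \<in> ball x d" "(f1 x1)\<^sup>2 \<noteq> (f1 x2)\<^sup>2"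
    using d(1) centre_in_ball by blast
  let ?T = "(\<lambda>x. (g1 x)\<^sup>2) ` ball y e"
  have T: "infinite ?T"
    by (rule infinite_square_image[where h'=g2]) (use e g in auto)
  have "b = 0 \<and> c = 0"
  proof (rule weingarten_elimination[OF T _ _ _ _ _ _ nz(1),
        where ?s1.0 = "1 + (f1 x1)\<^sup>2" and ?s2.0 = "1 + (f1 x2)\<^sup>2" and ?u1.0 = "f2 x1" and ?u2.0 = "f2 x2"])
    fix t assume "t \<in> ?T"
    then obtain z where z: "z \<in> ball y e" "t = (g1 z)\<^sup>2" by blast
    have zJ: "z \<in> J" "x1 \<in> I" "x2 \<in> I" using z x12 d e by auto
    show "\<exists>v. v \<noteq> 0 \<and>
       \<alpha> * sqrt (t + (1 + (f1 x1)\<^sup>2)) * (f2 x1 * (1 + t) + v * (1 + (f1 x1)\<^sup>2)) + b * f2 x1 * v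
         = c * (t + (1 + (f1 x1)\<^sup>2))\<^sup>2 \<and>
       \<alpha> * sqrt (t + (1 + (f1 x2)\<^sup>2)) * (f2 x2 * (1 + t) + v * (1 + (f1 x2)\<^sup>2)) + b * f2 x2 * v
         = c * (t + (1 + (f1 x2)\<^sup>2))\<^sup>2"
      using eq[OF zJ(2,1)] eq[OF zJ(3,1)] e(3)[OF z(1)] z(2)
      by (intro exI[of _ "g2 z"]) (simp add: add_ac)
  qed (use x12 d in \<open>auto simp: add_pos_nonneg\<close>)
  then show False using nz(2) by simp
qed

subsection \<open>Curvatures of a graph over an orthonormal frame\<close>

text \<open>No orientation is imposed, so two vectors may be exchanged or one reflected, and the
  results reused for the new frame.\<close>

locale orthonormal_frame =
  fixes a1 a2 a3 :: "real^3"
  assumes unit: "a1 \<bullet> a1 = 1" "a2 \<bullet> a2 = 1" "a3 \<bullet> a3 = 1"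
    and ortho: "a1 \<bullet> a2 = 0" "a1 \<bullet> a3 = 0" "a2 \<bullet> a3 = 0"
begin

lemma ortho': "a2 \<bullet> a1 = 0" "a3 \<bullet> a1 = 0" "a3 \<bullet> a2 = 0"
  using ortho by (simp_all add: inner_commute)

lemmas frame_simps = unit ortho ortho' inner_add_left inner_add_right inner_diff_left inner_diff_right

definition frame_matrix :: "real^3^3" where "frame_matrix = vector [a1, a2, a3]"

lemma frame_matrix_mult: "frame_matrix *v v = vector [a1 \<bullet> v, a2 \<bullet> v, a3 \<bullet> v]"
  unfolding frame_matrix_def by (simp add: vec_eq_iff forall_3 matrix_vector_mul_component)

lemma orthogonal_frame_matrix: "orthogonal_matrix frame_matrix"
  unfolding orthogonal_matrix_orthonormal_rows frame_matrix_def
  by (simp add: forall_3 row_def vec_lambda_eta unit ortho ortho' orthogonal_def norm_eq_sqrt_inner)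

text \<open>The matrix with the frame as rows sends a vector to its frame coordinates, and being
  orthogonal it preserves inner products.\<close>

lemma inner_frame: "v \<bullet> w = (v \<bullet> a1) * (w \<bullet> a1) + (v \<bullet> a2) * (w \<bullet> a2) + (v \<bullet> a3) * (w \<bullet> a3)"
proof -
  have "orthogonal_transformation ((*v) frame_matrix)"
    using orthogonal_frame_matrix by (simp add: orthogonal_transformation_matrix)
  then have "(frame_matrix *v v) \<bullet> (frame_matrix *v w) = v \<bullet> w"
    unfolding orthogonal_transformation_def by blast
  moreover have "(vector [x, y, z] :: real^3) \<bullet> vector [x', y', z'] = x * x' + y * y' + z * z'"
    for x y z x' y' z' :: real
    by (simp add: inner_vec_def sum_3)
  ultimately show ?thesis
    by (simp only: frame_matrix_mult inner_commute)
qed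

lemma frame_eqI:
  assumes "v \<bullet> a1 = w \<bullet> a1" "v \<bullet> a2 = w \<bullet> a2" "v \<bullet> a3 = w \<bullet> a3"
  shows "v = w"
proof -
  have "(v - w) \<bullet> (v - w) = 0"
    unfolding inner_frame[of "v - w" "v - w"] using assms by (simp add: inner_diff_left)
  then show ?thesis by simp
qed

definition patch :: "real^3 \<Rightarrow> (real \<Rightarrow> real) \<Rightarrow> (real \<Rightarrow> real) \<Rightarrow> real \<times> real \<Rightarrow> real^3" where
  "patch t f g = (\<lambda>(x, y). x *\<^sub>R a1 + y *\<^sub>R a2 + (f x + g y) *\<^sub>R a3 + t)"

lemma patch_coords:
  "(patch t f g (x, y) - t) \<bullet> a1 = x"
  "(patch t f g (x, y) - t) \<bullet> a2 = y"
  "(patch t f g (x, y) - t) \<bullet> a3 = f x + g y"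
  by (simp_all add: patch_def frame_simps)

lemma patch_eq_iff:
  "p = patch t f g (x, y) \<longleftrightarrow>
     (p - t) \<bullet> a1 = x \<and> (p - t) \<bullet> a2 = y \<and> (p - t) \<bullet> a3 = f x + g y" (is "?L \<longleftrightarrow> ?R")
proof
  assume ?R
  then have "p - t = patch t f g (x, y) - t"
    by (intro frame_eqI) (simp_all add: patch_coords)
  then show ?L by simp
qed (simp add: patch_coords)

text \<open>Membership is tested on the frame coordinates of \<open>p - t\<close> alone, so patches
  can be compared and cut out of larger sets without their parameters.\<close>

lemma patch_image_iff:
  "p \<in> patch t f g ` (I \<times> J) \<longleftrightarrow>
     (p - t) \<bullet> a1 \<in> I \<and> (p - t) \<bullet> a2 \<in> J \<and> (p - t) \<bullet> a3 = f ((p - t) \<bullet> a1) + g ((p - t) \<bullet> a2)"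
  by (auto simp: image_iff patch_eq_iff)

lemma patch_has_derivative:
  assumes "(f has_real_derivative p) (at x)" "(g has_real_derivative q) (at y)"
  shows "(patch t f g has_derivative
    (\<lambda>d. fst d *\<^sub>R (a1 + p *\<^sub>R a3) + snd d *\<^sub>R (a2 + q *\<^sub>R a3))) (at (x, y))"
proof -
  have "((\<lambda>z. f (fst z)) has_derivative (\<lambda>d. p * fst d)) (at (x, y))"
    using has_derivative_compose[OF has_derivative_fst[OF has_derivative_ident], of f "(*) p" "(x, y)" UNIV] assms(1)
    by (simp add: has_field_derivative_def)
  moreover have "((\<lambda>z. g (snd z)) has_derivative (\<lambda>d. q * snd d)) (at (x, y))"
    using has_derivative_compose[OF has_derivative_snd[OF has_derivative_ident], of g "(*) q" "(x, y)" UNIV] assms(2)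
    by (simp add: has_field_derivative_def)
  ultimately show ?thesis
    unfolding patch_def case_prod_beta
    by (auto intro!: derivative_eq_intros simp: algebra_simps)
qed

lemma patch_partials:
  assumes "(f has_real_derivative p) (at x)" "(g has_real_derivative q) (at y)"
  shows "Du (patch t f g) (x, y) = a1 + p *\<^sub>R a3" "Dv (patch t f g) (x, y) = a2 + q *\<^sub>R a3"
  unfolding Du_def Dv_def frechet_derivative_at[OF patch_has_derivative[OF assms, of t], symmetric]
  by simp_all

end

lemma vanishing_combination_inj:
  fixes L :: "real \<times> real \<Rightarrow> 'a::real_vector"
  assumes "linear L" "inj L" "\<alpha> *\<^sub>R L (1, 0) + \<beta> *\<^sub>R L (0, 1) = 0"
  shows "\<alpha> = 0 \<and> \<beta> = 0"
proof -
  have "L (\<alpha>, \<beta>) = L (\<alpha> *\<^sub>R (1, 0) + \<beta> *\<^sub>R (0, 1))" by simp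
  also have "\<dots> = L 0" using assms(1,3) by (simp only: linear_add linear_scale linear_0)
  finally show ?thesis using assms(2) by (auto dest: injD simp: zero_prod_def)
qed

context orthonormal_frame
begin

text \<open>On a neighbourhood of \<open>r\<close> the coordinates of \<open>Y\<close> satisfy \<open>Y\<^sub>3 = f Y\<^sub>1 + g Y\<^sub>2\<close>, which
  determines the normal components of the second derivatives of \<open>Y\<close> without inverting any map.\<close>

lemma curvature_param_patch:
  assumes f: "\<And>x. x \<in> I \<Longrightarrow> (f has_real_derivative f1 x) (at x)"
      "\<And>x. x \<in> I \<Longrightarrow> (f1 has_real_derivative f2 x) (at x)"
    and g: "\<And>y. y \<in> J \<Longrightarrow> (g has_real_derivative g1 y) (at y)"
      "\<And>y. y \<in> J \<Longrightarrow> (g1 has_real_derivative g2 y) (at y)"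
    and S: "openin (top_of_set S) (patch t f g ` (I \<times> J))"
    and Y: "local_parametrization S V Y" and r: "r \<in> V" "Y r = patch t f g (x, y)"
    and xy: "x \<in> I" "y \<in> J"
    and n: "n \<bullet> (a1 + f1 x *\<^sub>R a3) = 0" "n \<bullet> (a2 + g1 y *\<^sub>R a3) = 0"
  shows "mean_curvature_param Y n r =
      (n \<bullet> a3) * (f2 x * (1 + (g1 y)\<^sup>2) + g2 y * (1 + (f1 x)\<^sup>2)) / (2 * (1 + (f1 x)\<^sup>2 + (g1 y)\<^sup>2))"
    and "gauss_curvature_param Y n r =
      (n \<bullet> a3)\<^sup>2 * (f2 x * g2 y) / (1 + (f1 x)\<^sup>2 + (g1 y)\<^sup>2)"
proof -
  have V: "open V" "smooth_on V Y" "Y ` V \<subseteq> S" "inj (frechet_derivative Y (at r))"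
    using Y r openin_imp_subset unfolding local_parametrization_def by blast+
  define DY where "DY = (\<lambda>s. frechet_derivative Y (at s))"
  define D2 where "D2 = (\<lambda>d. frechet_derivative (\<lambda>s. DY s d) (at r))"
  have "C_k_on (Suc (Suc 0)) V Y" using V(2) unfolding smooth_on_def by blast
  then have C: "\<forall>x\<in>V. Y differentiable at x" "\<And>d. C_k_on (Suc 0) V (\<lambda>s. DY s d)"
    unfolding DY_def C_k_on.simps(2)[of "Suc 0"] by blast+
  have dY: "(Y has_derivative DY s) (at s)" if "s \<in> V" for s
    using C(1) that unfolding DY_def by (simp flip: frechet_derivative_works)
  have d2Y: "((\<lambda>s. DY s d) has_derivative D2 d) (at r)" for d
    using C(2) r(1) unfolding D2_def by (simp flip: frechet_derivative_works)
  define \<phi>1 \<phi>2 \<phi>3 where "\<phi>1 = (\<lambda>s. (Y s - t) \<bullet> a1)" and "\<phi>2 = (\<lambda>s. (Y s - t) \<bullet> a2)"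
    and "\<phi>3 = (\<lambda>s. (Y s - t) \<bullet> a3)"
  \<comment> \<open>The patch is relatively open in \<open>S\<close>, so this is an open
    neighbourhood of \<open>r\<close> on which \<open>Y\<close> stays in the graph.\<close>
  define V' where "V' = V \<inter> Y -` (patch t f g ` (I \<times> J))"
  have V': "open V'"
  proof -
    obtain T where T: "open T" "patch t f g ` (I \<times> J) = S \<inter> T" using S by (auto simp: openin_open)
    have "V' = V \<inter> Y -` T" using T(2) V(3) unfolding V'_def by blast
    moreover have "continuous_on V Y"
      using dY has_derivative_continuous continuous_at_imp_continuous_on by blast
    ultimately show ?thesis using continuous_open_preimage[OF _ V(1) T(1)] by simp
  qed
  have r': "r \<in> V'" using r xy by (simp add: V'_def)
  have inV: "s \<in> V" "\<phi>1 s \<in> I" "\<phi>2 s \<in> J" "\<phi>3 s = f (\<phi>1 s) + g (\<phi>2 s)" if "s \<in> V'" for s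
    using that unfolding V'_def \<phi>1_def \<phi>2_def \<phi>3_def by (auto simp: patch_image_iff)
  have \<phi>r: "\<phi>1 r = x" "\<phi>2 r = y" using r(2) unfolding \<phi>1_def \<phi>2_def by (simp_all add: patch_coords)
  have d\<phi>: "(\<phi>1 has_derivative (\<lambda>d. DY s d \<bullet> a1)) (at s)" "(\<phi>2 has_derivative (\<lambda>d. DY s d \<bullet> a2)) (at s)"
    "(\<phi>3 has_derivative (\<lambda>d. DY s d \<bullet> a3)) (at s)" if "s \<in> V" for s
    unfolding \<phi>1_def \<phi>2_def \<phi>3_def by (auto intro!: derivative_eq_intros dY[OF that])
  have comp: "((\<lambda>s. h (\<phi> s)) has_derivative (\<lambda>d. h' * L d)) (at s)"
    if "(h has_real_derivative h') (at (\<phi> s))" "(\<phi> has_derivative L) (at s)"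
    for h h' L s and \<phi> :: "real \<times> real \<Rightarrow> real"
    using has_derivative_compose[OF that(2), of h "(*) h'"] that(1) by (simp add: has_field_derivative_def)
  \<comment> \<open>This differentiates \<open>\<phi>3 = f \<phi>1 + g \<phi>2\<close> along
    \<open>d\<close>; \<open>second\<close> differentiates the outcome once more at
    \<open>r\<close>.\<close>
  have tang: "DY s d \<bullet> a3 = f1 (\<phi>1 s) * (DY s d \<bullet> a1) + g1 (\<phi>2 s) * (DY s d \<bullet> a2)" if s: "s \<in> V'" for s d
  proof -
    have "((\<lambda>s. f (\<phi>1 s) + g (\<phi>2 s)) has_derivative
        (\<lambda>d. f1 (\<phi>1 s) * (DY s d \<bullet> a1) + g1 (\<phi>2 s) * (DY s d \<bullet> a2))) (at s)"
      by (intro has_derivative_add comp d\<phi> f g inV[OF s])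
    then have "(\<phi>3 has_derivative
        (\<lambda>d. f1 (\<phi>1 s) * (DY s d \<bullet> a1) + g1 (\<phi>2 s) * (DY s d \<bullet> a2))) (at s)"
      by (rule has_derivative_transform_within_open[OF _ V' s]) (simp add: inV)
    from has_derivative_unique[OF this d\<phi>(3)[OF inV(1)[OF s]]] show ?thesis by metis
  qed
  have second: "D2 d e \<bullet> a3 = f2 x * (DY r e \<bullet> a1) * (DY r d \<bullet> a1) + f1 x * (D2 d e \<bullet> a1)
      + (g2 y * (DY r e \<bullet> a2) * (DY r d \<bullet> a2) + g1 y * (D2 d e \<bullet> a2))" for d e
  proof -
    have i: "((\<lambda>s. DY s d \<bullet> a) has_derivative (\<lambda>e. D2 d e \<bullet> a)) (at r)" for a
      by (auto intro!: derivative_eq_intros d2Y)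
    have "((\<lambda>s. f1 (\<phi>1 s) * (DY s d \<bullet> a1) + g1 (\<phi>2 s) * (DY s d \<bullet> a2)) has_derivative
       (\<lambda>e. (f1 (\<phi>1 r) * (D2 d e \<bullet> a1) + (f2 (\<phi>1 r) * (DY r e \<bullet> a1)) * (DY r d \<bullet> a1))
          + (g1 (\<phi>2 r) * (D2 d e \<bullet> a2) + (g2 (\<phi>2 r) * (DY r e \<bullet> a2)) * (DY r d \<bullet> a2)))) (at r)"
      by (intro has_derivative_add has_derivative_mult comp d\<phi> f g i inV[OF r'])
    then have "((\<lambda>s. DY s d \<bullet> a3) has_derivative
       (\<lambda>e. (f1 (\<phi>1 r) * (D2 d e \<bullet> a1) + (f2 (\<phi>1 r) * (DY r e \<bullet> a1)) * (DY r d \<bullet> a1))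
          + (g1 (\<phi>2 r) * (D2 d e \<bullet> a2) + (g2 (\<phi>2 r) * (DY r e \<bullet> a2)) * (DY r d \<bullet> a2)))) (at r)"
      by (rule has_derivative_transform_within_open[OF _ V' r']) (simp add: tang)
    from fun_cong[OF has_derivative_unique[OF this i], of e] show ?thesis
      unfolding \<phi>r by simp
  qed
  have n': "n \<bullet> a1 = - (f1 x * (n \<bullet> a3))" "n \<bullet> a2 = - (g1 y * (n \<bullet> a3))"
    using n by (simp_all add: inner_add_right)
  \<comment> \<open>By \<open>n'\<close> the components of \<open>D2 d e\<close> along
    \<open>a1\<close> and \<open>a2\<close> cancel against those in \<open>second\<close>; only
    terms quadratic in first derivatives of \<open>Y\<close> remain.\<close>
  have sff: "D2 d e \<bullet> n = (n \<bullet> a3) *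
      (f2 x * (DY r d \<bullet> a1) * (DY r e \<bullet> a1) + g2 y * (DY r d \<bullet> a2) * (DY r e \<bullet> a2))" for d e
    unfolding inner_frame[of "D2 d e" n] n' second by (simp add: algebra_simps)
  have fff: "DY r d \<bullet> DY r e = (DY r d \<bullet> a1) * (DY r e \<bullet> a1) + (DY r d \<bullet> a2) * (DY r e \<bullet> a2)
     + (f1 x * (DY r d \<bullet> a1) + g1 y * (DY r d \<bullet> a2)) * (f1 x * (DY r e \<bullet> a1) + g1 y * (DY r e \<bullet> a2))" for d e
    unfolding inner_frame[of "DY r d" "DY r e"] tang[OF r'] \<phi>r ..
  have fold: "frechet_derivative Y (at s) = DY s" "frechet_derivative (\<lambda>s. DY s d) (at r) = D2 d" for s d
    unfolding DY_def D2_def by simp_all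
  \<comment> \<open>These are the entries of the Jacobian matrix of (\<phi>1, \<phi>2) at
    \<open>r\<close>, and \<open>D\<close> is its determinant. The expressions in
    \<open>det\<close>, \<open>num\<close> and \<open>num'\<close> all carry the factor
    \<open>D^2\<close>, which cancels in the curvatures.\<close>
  define P Q R T where "P = DY r (1, 0) \<bullet> a1" and "Q = DY r (1, 0) \<bullet> a2"
    and "R = DY r (0, 1) \<bullet> a1" and "T = DY r (0, 1) \<bullet> a2"
  define D W M where "D = P * T - Q * R" and "W = 1 + (f1 x)\<^sup>2 + (g1 y)\<^sup>2"
    and "M = f2 x * (1 + (g1 y)\<^sup>2) + g2 y * (1 + (f1 x)\<^sup>2)"
  have lin: "linear (DY r)" "inj (DY r)"
    using dY[OF r(1)] has_derivative_linear V(4) unfolding DY_def by blast+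
  have D: "D \<noteq> 0"
  proof
    assume "D = 0"
    \<comment> \<open>By \<open>tang\<close> the \<open>a3\<close> component of a tangent vector is
      determined by the other two, so a dependence between \<open>(P, Q)\<close> and
      \<open>(R, T)\<close> is one between the partial derivatives of \<open>Y\<close>, against
      injectivity. If \<open>D = 0\<close>, the coefficients \<open>(R, - P)\<close> and
      \<open>(T, - Q)\<close> give such dependences.\<close>
    have vanish: "\<alpha> = 0 \<and> \<beta> = 0" if "\<alpha> * P + \<beta> * R = 0" "\<alpha> * Q + \<beta> * T = 0" for \<alpha> \<beta>
    proof (rule vanishing_combination_inj[OF lin])
      have "\<alpha> * (f1 x * P + g1 y * Q) + \<beta> * (f1 x * R + g1 y * T) = 0" using that by algebra
      then show "\<alpha> *\<^sub>R DY r (1, 0) + \<beta> *\<^sub>R DY r (0, 1) = 0"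
        using that unfolding P_def Q_def R_def T_def
        by (intro frame_eqI) (simp_all add: inner_add_left tang[OF r'] \<phi>r)
    qed
    have "R = 0 \<and> - P = 0" by (rule vanish) (use \<open>D = 0\<close> in \<open>simp_all add: D_def algebra_simps\<close>)
    moreover have "T = 0 \<and> - Q = 0" by (rule vanish) (use \<open>D = 0\<close> in \<open>simp_all add: D_def algebra_simps\<close>)
    ultimately show False using vanish[of 1 0] by simp
  qed
  have W: "W > 0" unfolding W_def by (simp add: add_pos_nonneg)
  define \<nu> where "\<nu> = n \<bullet> a3"
  have c: "sff_e Y n r = \<nu> * (f2 x * P * P + g2 y * Q * Q)" "sff_f Y n r = \<nu> * (f2 x * P * R + g2 y * Q * T)"
      "sff_g Y n r = \<nu> * (f2 x * R * R + g2 y * T * T)"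
    unfolding sff_e_def sff_f_def sff_g_def Du_def Dv_def P_def Q_def R_def T_def \<nu>_def
    by (simp_all only: fold sff)
  have EFG: "fff_E Y r = P * P + Q * Q + (f1 x * P + g1 y * Q) * (f1 x * P + g1 y * Q)"
      "fff_F Y r = P * R + Q * T + (f1 x * P + g1 y * Q) * (f1 x * R + g1 y * T)"
      "fff_G Y r = R * R + T * T + (f1 x * R + g1 y * T) * (f1 x * R + g1 y * T)"
    unfolding fff_E_def fff_F_def fff_G_def Du_def Dv_def P_def Q_def R_def T_def
    by (simp_all only: fold fff)
  have det: "fff_E Y r * fff_G Y r - (fff_F Y r)\<^sup>2 = D\<^sup>2 * W"
    unfolding EFG D_def W_def by algebra
  have num: "sff_e Y n r * fff_G Y r - 2 * sff_f Y n r * fff_F Y r + sff_g Y n r * fff_E Y r = D\<^sup>2 * (\<nu> * M)"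
    unfolding EFG c D_def M_def by algebra
  have num': "sff_e Y n r * sff_g Y n r - (sff_f Y n r)\<^sup>2 = D\<^sup>2 * (\<nu>\<^sup>2 * (f2 x * g2 y))"
    unfolding c D_def by algebra
  have "mean_curvature_param Y n r = (D\<^sup>2 * (\<nu> * M)) / (D\<^sup>2 * (2 * W))"
    unfolding mean_curvature_param_def num det by (simp add: mult.left_commute)
  then show "mean_curvature_param Y n r =
      (n \<bullet> a3) * (f2 x * (1 + (g1 y)\<^sup>2) + g2 y * (1 + (f1 x)\<^sup>2)) / (2 * (1 + (f1 x)\<^sup>2 + (g1 y)\<^sup>2))"
    using D unfolding \<nu>_def M_def W_def by simp
  have "gauss_curvature_param Y n r = (D\<^sup>2 * (\<nu>\<^sup>2 * (f2 x * g2 y))) / (D\<^sup>2 * W)"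
    unfolding gauss_curvature_param_def num' det ..
  then show "gauss_curvature_param Y n r =
      (n \<bullet> a3)\<^sup>2 * (f2 x * g2 y) / (1 + (f1 x)\<^sup>2 + (g1 y)\<^sup>2)"
    using D unfolding \<nu>_def W_def by simp
qed

text \<open>This resolves the definite descriptions: the patch itself supplies a value, and by
  \<open>curvature_param_patch\<close> every parametrization through \<open>p\<close> gives the same
  one. The last claim is the unit length of \<open>N p\<close> written in frame coordinates.\<close>

lemma curvature_patch:
  assumes f: "\<And>x. x \<in> I \<Longrightarrow> (f has_real_derivative f1 x) (at x)"
      "\<And>x. x \<in> I \<Longrightarrow> (f1 has_real_derivative f2 x) (at x)"
    and g: "\<And>y. y \<in> J \<Longrightarrow> (g has_real_derivative g1 y) (at y)"
      "\<And>y. y \<in> J \<Longrightarrow> (g1 has_real_derivative g2 y) (at y)"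
    and X: "local_parametrization S (I \<times> J) (patch t f g)"
    and N: "unit_normal_field S N"
    and xy: "x \<in> I" "y \<in> J"
  defines "p \<equiv> patch t f g (x, y)"
  shows "mean_curvature S N p = (N p \<bullet> a3) * (f2 x * (1 + (g1 y)\<^sup>2) + g2 y * (1 + (f1 x)\<^sup>2)) /
      (2 * (1 + (f1 x)\<^sup>2 + (g1 y)\<^sup>2))" (is "_ = ?h")
    and "gauss_curvature S N p = (N p \<bullet> a3)\<^sup>2 * (f2 x * g2 y) / (1 + (f1 x)\<^sup>2 + (g1 y)\<^sup>2)" (is "_ = ?k")
    and "(N p \<bullet> a3)\<^sup>2 * (1 + (f1 x)\<^sup>2 + (g1 y)\<^sup>2) = 1"
proof -
  have S: "openin (top_of_set S) (patch t f g ` (I \<times> J))"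
    using X unfolding local_parametrization_def by blast
  have pS: "p \<in> S" using openin_imp_subset[OF S] xy unfolding p_def by blast
  have "orthogonal (N p) (Du (patch t f g) (x, y))" "orthogonal (N p) (Dv (patch t f g) (x, y))"
    using N X xy unfolding unit_normal_field_def p_def by blast+
  then have n: "N p \<bullet> (a1 + f1 x *\<^sub>R a3) = 0" "N p \<bullet> (a2 + g1 y *\<^sub>R a3) = 0"
    unfolding patch_partials[OF f(1) g(1), OF xy] orthogonal_def by auto
  have curv: "mean_curvature_param Y (N p) r = ?h \<and> gauss_curvature_param Y (N p) r = ?k"
    if "local_parametrization S V Y" "r \<in> V" "Y r = p" for V Y r
    using curvature_param_patch[where f=f and g=g and ?f1.0=f1 and ?f2.0=f2 and ?g1.0=g1 and ?g2.0=g2,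
        OF f g S that(1,2) that(3)[unfolded p_def] xy n] by blast
  have curvX: "mean_curvature_param (patch t f g) (N p) (x, y) = ?h"
      "gauss_curvature_param (patch t f g) (N p) (x, y) = ?k"
    using curv[OF X] xy unfolding p_def by auto
  show "mean_curvature S N p = ?h"
    unfolding mean_curvature_def
  proof (rule the_equality)
    show "\<exists>U X q. local_parametrization S U X \<and> q \<in> U \<and> X q = p \<and> ?h = mean_curvature_param X (N p) q"
      using X xy curvX p_def by (metis mem_Sigma_iff)
  qed (use curv in metis)
  show "gauss_curvature S N p = ?k"
    unfolding gauss_curvature_def
  proof (rule the_equality)
    show "\<exists>U X q. local_parametrization S U X \<and> q \<in> U \<and> X q = p \<and> ?k = gauss_curvature_param X (N p) q"
      using X xy curvX p_def by (metis mem_Sigma_iff)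
  qed (use curv in metis)
  have n': "N p \<bullet> a1 = - (f1 x * (N p \<bullet> a3))" "N p \<bullet> a2 = - (g1 y * (N p \<bullet> a3))"
    using n by (simp_all add: inner_add_right)
  have "N p \<bullet> N p = 1" using N pS unfolding unit_normal_field_def by (simp add: norm_eq_1)
  then have "1 = N p \<bullet> N p" by simp
  also have "\<dots> = (N p \<bullet> a3)\<^sup>2 * (1 + (f1 x)\<^sup>2 + (g1 y)\<^sup>2)"
    unfolding inner_frame[of "N p" "N p"] n' by algebra
  finally show "(N p \<bullet> a3)\<^sup>2 * (1 + (f1 x)\<^sup>2 + (g1 y)\<^sup>2) = 1" by simp
qed

end

subsection \<open>Cylinders and Scherk surfaces\<close>

lemma zero_derivative_constant_on_convex:
  fixes f :: "real \<Rightarrow> real"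
  assumes "convex I" "\<And>x. x \<in> I \<Longrightarrow> (f has_real_derivative 0) (at x)"
  obtains c where "\<And>x. x \<in> I \<Longrightarrow> f x = c"
proof -
  have "\<exists>c. \<forall>x\<in>I. f x = c"
    by (rule has_field_derivative_zero_constant[OF assms(1)])
      (rule has_field_derivative_at_within, rule assms(2))
  then show thesis using that by blast
qed

lemma second_derivative_zero_imp_affine:
  fixes f :: "real \<Rightarrow> real"
  assumes "convex I"
    and f: "\<And>x. x \<in> I \<Longrightarrow> (f has_real_derivative f1 x) (at x)"
      "\<And>x. x \<in> I \<Longrightarrow> (f1 has_real_derivative 0) (at x)"
  shows "\<exists>\<alpha> \<beta>. \<forall>x\<in>I. f x = \<alpha> * x + \<beta>"
proof -
  obtain \<alpha> where \<alpha>: "\<And>x. x \<in> I \<Longrightarrow> f1 x = \<alpha>"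
    using zero_derivative_constant_on_convex[OF assms(1) f(2)] by metis
  have D: "((\<lambda>x. f x - \<alpha> * x) has_real_derivative 0) (at x)" if "x \<in> I" for x
    using f(1)[OF that] \<alpha>[OF that]
    by (auto intro!: derivative_eq_intros)
  obtain \<beta> where "\<And>x. x \<in> I \<Longrightarrow> f x - \<alpha> * x = \<beta>"
    using zero_derivative_constant_on_convex[OF assms(1) D] by metis
  then have "\<And>x. x \<in> I \<Longrightarrow> f x = \<alpha> * x + \<beta>" by (simp add: diff_eq_eq add.commute)
  then show ?thesis by blast
qed

text \<open>Separation of variables makes \<open>arctan h1 - m x\<close> constant, so
  \<open>h1 = tan (m x + c)\<close>, which integrates to a logarithm. The range of
  \<open>arctan\<close> makes the cosine positive.\<close>

lemma log_cos_ode: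
  fixes h h1 :: "real \<Rightarrow> real"
  assumes "convex I" and m: "m \<noteq> 0"
    and h: "\<And>x. x \<in> I \<Longrightarrow> (h has_real_derivative h1 x) (at x)"
      "\<And>x. x \<in> I \<Longrightarrow> (h1 has_real_derivative m * (1 + (h1 x)\<^sup>2)) (at x)"
  obtains c d where "\<And>x. x \<in> I \<Longrightarrow> cos (m * x + c) > 0"
    "\<And>x. x \<in> I \<Longrightarrow> h x = d - ln (cos (m * x + c)) / m"
proof -
  have D: "((\<lambda>x. arctan (h1 x) - m * x) has_real_derivative 0) (at x)" if "x \<in> I" for x
  proof -
    have "1 + (h1 x)\<^sup>2 \<noteq> 0" by (metis add_pos_nonneg less_irrefl zero_le_power2 zero_less_one)
    then show ?thesis
      using h(2)[OF that]
      by (auto intro!: derivative_eq_intros simp: field_simps)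
  qed
  obtain c where c: "\<And>x. x \<in> I \<Longrightarrow> arctan (h1 x) - m * x = c"
    using zero_derivative_constant_on_convex[OF assms(1) D] by metis
  have arc: "m * x + c = arctan (h1 x)" if "x \<in> I" for x using c[OF that] by simp
  have pos: "cos (m * x + c) > 0" and tan: "tan (m * x + c) = h1 x" if "x \<in> I" for x
    unfolding arc[OF that] using arctan_bounded[of "h1 x"] by (simp_all add: cos_gt_zero_pi tan_arctan)
  have D: "((\<lambda>x. h x + ln (cos (m * x + c)) / m) has_real_derivative 0) (at x)" if "x \<in> I" for x
  proof -
    have D: "((\<lambda>x. h x + ln (cos (m * x + c)) / m) has_real_derivative
        h1 x + (- sin (m * x + c) * m) / cos (m * x + c) / m) (at x)"
      using h(1)[OF that] pos[OF that] by (auto intro!: derivative_eq_intros)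
    moreover have "h1 x + (- sin (m * x + c) * m) / cos (m * x + c) / m = 0"
      using tan[OF that] m by (simp add: tan_def)
    ultimately show ?thesis by simp
  qed
  obtain d where "\<And>x. x \<in> I \<Longrightarrow> h x + ln (cos (m * x + c)) / m = d"
    using zero_derivative_constant_on_convex[OF assms(1) D] by metis
  then have "\<And>x. x \<in> I \<Longrightarrow> h x = d - ln (cos (m * x + c)) / m" by (simp add: eq_diff_eq)
  then show thesis using that pos by blast
qed

lemma rigid_motion_id: "rigid_motion (\<lambda>x. x)"
  unfolding rigid_motion_def rotation_matrix_def
  by (intro exI[of _ "mat 1"] exI[of _ 0]) (simp add: orthogonal_matrix_id)

section \<open>Patches with an affine profile function as pieces of cylinders\<close>

context orthonormal_frame
begin

lemma swapped_frame: "orthonormal_frame a2 a1 a3"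
  by unfold_locales (simp_all add: unit ortho ortho')

text \<open>Exchanging \<open>x\<close> and \<open>y\<close> reduces statements about
  \<open>g\<close> to the same statements about \<open>f\<close>.\<close>

lemma swapped_patch:
  "orthonormal_frame.patch a2 a1 a3 t g f ` (J \<times> I) = patch t f g ` (I \<times> J)"
proof -
  interpret swap: orthonormal_frame a2 a1 a3 by (rule swapped_frame)
  show ?thesis by (auto simp: set_eq_iff patch_image_iff swap.patch_image_iff add.commute)
qed

text \<open>The patch is the curve \<gamma> moved along a fixed direction, so it inherits smoothness
  from \<gamma>. The first two frame coordinates provide the inverse map and also show that the
  differential is injective.\<close>

lemma cylinder_local_parametrization:
  assumes J: "open J" and g: "smooth_on J g"
    and \<gamma>: "smooth_on J (\<lambda>s. s *\<^sub>R a2 + (\<beta> + g s) *\<^sub>R a3 + t)"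
  shows "local_parametrization (patch t (\<lambda>x. \<alpha> * x + \<beta>) g ` (UNIV \<times> J)) (UNIV \<times> J)
    (patch t (\<lambda>x. \<alpha> * x + \<beta>) g)"
proof -
  let ?X = "patch t (\<lambda>x. \<alpha> * x + \<beta>) g"
  let ?\<gamma> = "\<lambda>s. s *\<^sub>R a2 + (\<beta> + g s) *\<^sub>R a3 + t"
  let ?Y = "\<lambda>p. ((p - t) \<bullet> a1, (p - t) \<bullet> a2)"
  obtain g1 where g1: "\<And>y. y \<in> J \<Longrightarrow> (g has_real_derivative g1 y) (at y)"
    using smooth_on_real_second_derivative[OF g] by metis
  have U: "open (UNIV \<times> J :: (real \<times> real) set)" using J by (simp add: open_Times)
  have "smooth_on (UNIV \<times> J) ?X"
    unfolding smooth_on_def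
  proof
    fix k
    have "C_k_on k (UNIV \<times> J :: (real \<times> real) set) (\<lambda>q. ?\<gamma> (snd q) + fst q *\<^sub>R (a1 + \<alpha> *\<^sub>R a3))"
    proof (rule C_k_on_add[OF U])
      show "C_k_on k (UNIV \<times> J :: (real \<times> real) set) (\<lambda>q. ?\<gamma> (snd q))"
        by (rule C_k_on_compose_bounded_linear[OF U bounded_linear_snd, where f="?\<gamma>" and W=J])
          (use \<gamma> in \<open>auto simp: smooth_on_def\<close>)
      show "C_k_on k (UNIV \<times> J :: (real \<times> real) set) (\<lambda>q. fst q *\<^sub>R (a1 + \<alpha> *\<^sub>R a3))"
        by (intro C_k_on_bounded_linear bounded_linear_scaleR_left[THEN bounded_linear_compose] bounded_linear_fst)
    qed
    then show "C_k_on k (UNIV \<times> J) ?X"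
      by (rule C_k_on_cong[OF U, rotated]) (auto simp: patch_def algebra_simps)
  qed
  moreover have "homeomorphism (UNIV \<times> J) (?X ` (UNIV \<times> J)) ?X ?Y"
  proof (rule homeomorphismI)
    show "continuous_on (UNIV \<times> J) ?X"
      by (intro continuous_at_imp_continuous_on) (auto intro!: has_derivative_continuous patch_has_derivative derivative_eq_intros g1)
    show "continuous_on (?X ` (UNIV \<times> J)) ?Y" by (intro continuous_intros)
  qed (auto simp: patch_coords)
  moreover have "inj (frechet_derivative ?X (at q))" if q: "q \<in> UNIV \<times> J" for q
  proof -
    obtain x y where xy: "q = (x, y)" "y \<in> J" using q by auto
    have "((\<lambda>x. \<alpha> * x + \<beta>) has_real_derivative \<alpha>) (at x)" by (auto intro!: derivative_eq_intros)
    from frechet_derivative_at[OF patch_has_derivative[OF this g1[OF xy(2)], of t], symmetric]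
    have eq: "frechet_derivative ?X (at q) = (\<lambda>d. fst d *\<^sub>R (a1 + \<alpha> *\<^sub>R a3) + snd d *\<^sub>R (a2 + g1 y *\<^sub>R a3))"
      unfolding xy(1) .
    show ?thesis
      unfolding eq
    proof (rule injI)
      fix d e :: "real \<times> real"
      assume "fst d *\<^sub>R (a1 + \<alpha> *\<^sub>R a3) + snd d *\<^sub>R (a2 + g1 y *\<^sub>R a3) =
         fst e *\<^sub>R (a1 + \<alpha> *\<^sub>R a3) + snd e *\<^sub>R (a2 + g1 y *\<^sub>R a3)" (is "?l = ?r")
      then have "?l \<bullet> a1 = ?r \<bullet> a1" "?l \<bullet> a2 = ?r \<bullet> a2" by simp_all
      then show "d = e" by (simp add: frame_simps prod_eq_iff)
    qed
  qed
  ultimately show ?thesis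
    using U unfolding local_parametrization_def by auto
qed

text \<open>Extending the ruling segments to full lines gives \<open>M\<close>, in which the patch
  is the relatively open part with first coordinate in \<open>I\<close>; the identity serves as
  rigid motion. The directrix lies in a plane normal to \<open>a1\<close>, while the rulings have
  \<open>a1\<close> component 1.\<close>

lemma cylinder_patch:
  assumes J: "open J" "is_interval J" and g: "smooth_on J g"
    and I: "open I" and f: "\<And>x. x \<in> I \<Longrightarrow> f x = \<alpha> * x + \<beta>"
    and S: "openin (top_of_set S) (patch t f g ` (I \<times> J))"
    and p: "p \<in> patch t f g ` (I \<times> J)"
  shows "\<exists>M. generalized_cylinder M \<and> locally_congruent_at S p M"
proof -
  let ?\<gamma> = "\<lambda>s. s *\<^sub>R a2 + (\<beta> + g s) *\<^sub>R a3 + t" and ?w = "a1 + \<alpha> *\<^sub>R a3"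
  define M where "M = patch t (\<lambda>x. \<alpha> * x + \<beta>) g ` (UNIV \<times> J)"
  obtain g1 where g1: "\<And>y. y \<in> J \<Longrightarrow> (g has_real_derivative g1 y) (at y)"
    using smooth_on_real_second_derivative[OF g] by metis
  have \<gamma>: "smooth_on J ?\<gamma>"
    unfolding smooth_on_def
  proof
    fix k
    have "C_k_on k J (\<lambda>s. s *\<^sub>R a2 + (g s *\<^sub>R a3 + (\<beta> *\<^sub>R a3 + t)))"
      using g unfolding smooth_on_def
      by (intro C_k_on_add J C_k_on_const C_k_on_bounded_linear[OF bounded_linear_scaleR_left]
          C_k_on_bounded_linear_compose[OF J(1) bounded_linear_scaleR_left]) blast
    then show "C_k_on k J ?\<gamma>"
      by (rule C_k_on_cong[OF J(1), rotated]) (simp add: algebra_simps)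
  qed
  have "vector_derivative ?\<gamma> (at s) \<noteq> 0" if "s \<in> J" for s
  proof -
    have "(?\<gamma> has_vector_derivative (a2 + g1 s *\<^sub>R a3)) (at s)"
      using g1[OF that] by (auto intro!: derivative_eq_intros)
    then have "vector_derivative ?\<gamma> (at s) = a2 + g1 s *\<^sub>R a3" by (rule vector_derivative_at)
    moreover have "(a2 + g1 s *\<^sub>R a3) \<bullet> a2 = 1" by (simp add: frame_simps)
    ultimately show ?thesis by auto
  qed
  moreover have "smooth_surface M"
    unfolding smooth_surface_def
    using cylinder_local_parametrization[OF J(1) g \<gamma>, of \<alpha>] unfolding M_def by blast
  moreover have "M = {?\<gamma> s + r *\<^sub>R ?w |s r. s \<in> J}"
  proof -
    have "patch t (\<lambda>x. \<alpha> * x + \<beta>) g (r, s) = ?\<gamma> s + r *\<^sub>R ?w" for r s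
      by (simp add: patch_def algebra_simps)
    then show ?thesis unfolding M_def by (auto simp: image_iff) metis+
  qed
  moreover have "\<forall>s\<in>J. a1 \<bullet> ?\<gamma> s = a1 \<bullet> t" "a1 \<bullet> ?w \<noteq> 0" by (simp_all add: frame_simps)
  moreover have "J \<noteq> {}" using p by auto
  ultimately have "generalized_cylinder M"
    unfolding generalized_cylinder_def using J \<gamma> by blast
  moreover have "locally_congruent_at S p M"
  proof -
    have "patch t f g ` (I \<times> J) = M \<inter> (\<lambda>z. (z - t) \<bullet> a1) -` I"
      by (intro set_eqI) (auto simp only: M_def patch_image_iff Int_iff vimage_eq UNIV_I f)
    moreover have "open ((\<lambda>z. (z - t) \<bullet> a1) -` I)"
      by (intro open_vimage I continuous_intros)
    ultimately have "openin (top_of_set M) ((\<lambda>x. x) ` patch t f g ` (I \<times> J))"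
      by (simp add: openin_open_Int)
    then show ?thesis
      unfolding locally_congruent_at_def using S p rigid_motion_id by blast
  qed
  ultimately show ?thesis by blast
qed

section \<open>Patches of logarithms of cosines as pieces of Scherk surfaces\<close>

lemma orthonormal_frame_minus: "orthonormal_frame (- a1) a2 a3"
  by unfold_locales (simp_all add: unit ortho)

text \<open>Negating \<open>a1\<close> flips the sign of the determinant, so one of the two signs
  gives determinant 1.\<close>

lemma rotation_frame:
  obtains \<sigma> :: real where "\<sigma> = 1 \<or> \<sigma> = - 1" "rotation_matrix (vector [\<sigma> *\<^sub>R a1, a2, a3] :: real^3^3)"
proof -
  interpret minus: orthonormal_frame "- a1" a2 a3 by (rule orthonormal_frame_minus)
  have "det (minus.frame_matrix) = - det frame_matrix"
    unfolding frame_matrix_def minus.frame_matrix_def by (simp add: det_3)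
  moreover have "det frame_matrix = 1 \<or> det frame_matrix = - 1"
    using det_orthogonal_matrix[OF orthogonal_frame_matrix] .
  ultimately have "rotation_matrix frame_matrix \<or> rotation_matrix minus.frame_matrix"
    unfolding rotation_matrix_def using orthogonal_frame_matrix minus.orthogonal_frame_matrix by auto
  then show thesis
    using that[of 1] that[of "- 1"] unfolding frame_matrix_def minus.frame_matrix_def by auto
qed

text \<open>The Scherk surface is invariant under the reflection \<open>x \<mapsto> - x\<close>, which is used to make the
  congruence orientation preserving.\<close>

lemma scherk_patch:
  assumes I: "open I" "convex I" and J: "open J" "convex J" and m: "m > 0"
    and f: "\<And>x. x \<in> I \<Longrightarrow> (f has_real_derivative f1 x) (at x)"
      "\<And>x. x \<in> I \<Longrightarrow> (f1 has_real_derivative m * (1 + (f1 x)\<^sup>2)) (at x)"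
    and g: "\<And>y. y \<in> J \<Longrightarrow> (g has_real_derivative g1 y) (at y)"
      "\<And>y. y \<in> J \<Longrightarrow> (g1 has_real_derivative - m * (1 + (g1 y)\<^sup>2)) (at y)"
    and S: "openin (top_of_set S) (patch t f g ` (I \<times> J))"
    and p: "p \<in> patch t f g ` (I \<times> J)"
  shows "locally_congruent_at S p (scherk_surface m)"
proof -
  obtain c1 d1 where c1: "\<And>x. x \<in> I \<Longrightarrow> cos (m * x + c1) > 0"
      "\<And>x. x \<in> I \<Longrightarrow> f x = d1 - ln (cos (m * x + c1)) / m"
    using log_cos_ode[OF I(2) _ f] m by (metis less_irrefl)
  obtain c2 d2 where c2: "\<And>y. y \<in> J \<Longrightarrow> cos (- m * y + c2) > 0"
      "\<And>y. y \<in> J \<Longrightarrow> g y = d2 - ln (cos (- m * y + c2)) / - m"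
    using log_cos_ode[OF J(2) _ g] m by (metis less_irrefl neg_equal_0_iff_equal)
  obtain \<sigma> :: real where \<sigma>: "\<sigma> = 1 \<or> \<sigma> = - 1"
      "rotation_matrix (vector [\<sigma> *\<^sub>R a1, a2, a3] :: real^3^3)"
    using rotation_frame by blast
  define B :: "real^3^3" where "B = vector [\<sigma> *\<^sub>R a1, a2, a3]"
  \<comment> \<open>The shift puts the origin at \<open>t\<close> and absorbs the phases
    \<open>c1\<close>, \<open>c2\<close> and the heights \<open>d1\<close>, \<open>d2\<close>, as
    \<open>T\<close> below displays.\<close>
  define b :: "real^3" where
    "b = vector [\<sigma> * (c1 / m - t \<bullet> a1), - (c2 / m) - t \<bullet> a2, - (d1 + d2) - t \<bullet> a3]"
  define T where "T = (\<lambda>z. B *v z + b)"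
  have T: "T z = vector [\<sigma> * ((z - t) \<bullet> a1 + c1 / m), (z - t) \<bullet> a2 - c2 / m, (z - t) \<bullet> a3 - (d1 + d2)]" for z
    unfolding T_def B_def b_def
    by (simp add: vec_eq_iff forall_3 matrix_vector_mul_component inner_diff_left inner_commute algebra_simps)
  have "rigid_motion T" unfolding rigid_motion_def T_def using \<sigma>(2) B_def by blast
  have \<sigma>\<sigma>: "\<sigma> * (\<sigma> * r) = r" for r using \<sigma>(1) by auto
  \<comment> \<open>This pulls \<open>I\<close> and \<open>J\<close> back under the inverse
    substitution \<open>x = \<sigma> X - c1 / m\<close>, \<open>y = Y + c2 / m\<close>, and so cuts
    the image of the patch out of the full Scherk surface.\<close>
  define \<Omega> where "\<Omega> = (\<lambda>w :: real^3. \<sigma> * w $ 1 - c1 / m) -` I \<inter> (\<lambda>w :: real^3. w $ 2 + c2 / m) -` J"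
  have \<Omega>: "open \<Omega>"
    unfolding \<Omega>_def by (intro open_Int open_vimage I J continuous_intros)
  have TX: "T (patch t f g (x, y)) = vector [\<sigma> * (x + c1 / m), y - c2 / m,
        (1 / m) * (ln (cos (m * (y - c2 / m))) - ln (cos (m * (\<sigma> * (x + c1 / m)))))]"
      and pos: "cos (m * (\<sigma> * (x + c1 / m))) > 0" "cos (m * (y - c2 / m)) > 0"
    if "x \<in> I" "y \<in> J" for x y
  proof -
    have "m * (\<sigma> * (x + c1 / m)) = \<sigma> * (m * x + c1)" using m by (simp add: field_simps)
    then have "cos (m * (\<sigma> * (x + c1 / m))) = cos (\<sigma> * (m * x + c1))" by (rule arg_cong)
    also have "\<dots> = cos (m * x + c1)"
      using \<sigma>(1) cos_minus[of "m * x + c1"] by auto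
    finally have 1: "cos (m * (\<sigma> * (x + c1 / m))) = cos (m * x + c1)" .
    have "m * (y - c2 / m) = - (- m * y + c2)" using m by (simp add: field_simps)
    then have 2: "cos (m * (y - c2 / m)) = cos (- m * y + c2)" by (metis cos_minus)
    show "cos (m * (\<sigma> * (x + c1 / m))) > 0" "cos (m * (y - c2 / m)) > 0"
      unfolding 1 2 using c1 c2 that by blast+
    show "T (patch t f g (x, y)) = vector [\<sigma> * (x + c1 / m), y - c2 / m,
        (1 / m) * (ln (cos (m * (y - c2 / m))) - ln (cos (m * (\<sigma> * (x + c1 / m)))))]"
      unfolding T patch_coords 1 2 c1(2)[OF that(1)] c2(2)[OF that(2)]
      by (simp add: diff_divide_distrib)
  qed
  have "T ` patch t f g ` (I \<times> J) = scherk_surface m \<inter> \<Omega>"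
  proof (intro equalityI subsetI)
    fix w assume "w \<in> T ` patch t f g ` (I \<times> J)"
    then obtain x y where xy: "x \<in> I" "y \<in> J" "w = T (patch t f g (x, y))" by auto
    have "w \<in> scherk_surface m"
      unfolding scherk_surface_def xy(3) TX[OF xy(1,2)] using pos[OF xy(1,2)] by blast
    moreover have "w \<in> \<Omega>" unfolding \<Omega>_def xy(3) TX[OF xy(1,2)] using xy by (simp add: \<sigma>\<sigma>)
    ultimately show "w \<in> scherk_surface m \<inter> \<Omega>" by blast
  next
    fix w assume w: "w \<in> scherk_surface m \<inter> \<Omega>"
    then obtain X Y where XY: "w = vector [X, Y, (1 / m) * (ln (cos (m * Y)) - ln (cos (m * X)))]"
      unfolding scherk_surface_def by blast
    have xy: "\<sigma> * X - c1 / m \<in> I" "Y + c2 / m \<in> J" using w unfolding \<Omega>_def XY by simp_all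
    have "w = T (patch t f g (\<sigma> * X - c1 / m, Y + c2 / m))"
      unfolding TX[OF xy] XY by (simp add: \<sigma>\<sigma>)
    then show "w \<in> T ` patch t f g ` (I \<times> J)" using xy by blast
  qed
  then have "openin (top_of_set (scherk_surface m)) (T ` patch t f g ` (I \<times> J))"
    using \<Omega> by (simp add: openin_open_Int)
  then show ?thesis
    unfolding locally_congruent_at_def using S p \<open>rigid_motion T\<close> by blast
qed

end

subsection \<open>Linear Weingarten translation surfaces\<close>

lemma continuous_nonzero_sign:
  fixes \<nu> :: "'a::topological_space \<Rightarrow> real"
  assumes "connected U" "continuous_on U \<nu>" "\<And>z. z \<in> U \<Longrightarrow> \<nu> z \<noteq> 0"
  shows "\<exists>\<epsilon>::real. (\<epsilon> = 1 \<or> \<epsilon> = - 1) \<and> (\<forall>z\<in>U. \<epsilon> * \<nu> z > 0)"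
proof -
  have conn: "is_interval (\<nu> ` U)"
    using connected_continuous_image[OF assms(2,1)] by (simp add: is_interval_connected_1)
  have "(\<forall>z\<in>U. \<nu> z > 0) \<or> (\<forall>z\<in>U. \<nu> z < 0)"
  proof (rule ccontr)
    assume "\<not> ?thesis"
    then obtain z w where zw: "z \<in> U" "\<nu> z \<le> 0" "w \<in> U" "\<nu> w \<ge> 0" by force
    then have "0 \<in> \<nu> ` U"
      using conn unfolding is_interval_1 by (meson imageI)
    then show False using assms(3) by force
  qed
  then show ?thesis by (auto intro: exI[of _ 1] exI[of _ "- 1"])
qed

context orthonormal_frame
begin

text \<open>This is the local form of the result, with \<open>a\<close>, \<open>b\<close>,
  \<open>c\<close> given beforehand so that all patches fall under the same case.\<close>

lemma weingarten_translation_patch: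
  assumes I: "open I" "is_interval I" and J: "open J" "is_interval J"
    and fg: "smooth_on I f" "smooth_on J g"
    and X: "local_parametrization S (I \<times> J) (patch t f g)"
    and N: "unit_normal_field S N"
    and nz: "\<not> (a = 0 \<and> b = 0 \<and> c = 0)"
    and weingarten: "\<And>p. p \<in> S \<Longrightarrow> a * mean_curvature S N p + b * gauss_curvature S N p = c"
    and p: "p \<in> patch t f g ` (I \<times> J)"
  shows "(\<not> (b = 0 \<and> c = 0) \<longrightarrow> gauss_curvature S N p = 0) \<and>
    (\<exists>M. (generalized_cylinder M \<or> (\<exists>l>0. M = scherk_surface l)) \<and> locally_congruent_at S p M)"
    (is "_ \<and> ?congruent")
proof -
  obtain f1 f2 where f: "\<And>x. x \<in> I \<Longrightarrow> (f has_real_derivative f1 x) (at x)"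
      "\<And>x. x \<in> I \<Longrightarrow> (f1 has_real_derivative f2 x) (at x)" "continuous_on I f2"
    using smooth_on_real_second_derivative[OF fg(1)] by blast
  obtain g1 g2 where g: "\<And>y. y \<in> J \<Longrightarrow> (g has_real_derivative g1 y) (at y)"
      "\<And>y. y \<in> J \<Longrightarrow> (g1 has_real_derivative g2 y) (at y)" "continuous_on J g2"
    using smooth_on_real_second_derivative[OF fg(2)] by blast
  have S: "openin (top_of_set S) (patch t f g ` (I \<times> J))"
    using X unfolding local_parametrization_def by blast
  have conv: "convex I" "convex J" using I J by (simp_all add: is_interval_convex)
  \<comment> \<open>This is \<open>1 + p^2 + q^2\<close>, the square of the W in the
    overview.\<close>
  define W where "W = (\<lambda>x y. 1 + (f1 x)\<^sup>2 + (g1 y)\<^sup>2)"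
  define M where "M = (\<lambda>x y. f2 x * (1 + (g1 y)\<^sup>2) + g2 y * (1 + (f1 x)\<^sup>2))"
  define \<nu> where "\<nu> = (\<lambda>x y. N (patch t f g (x, y)) \<bullet> a3)"
  have W: "W x y > 0" for x y unfolding W_def by (simp add: add_pos_nonneg)
  have H: "mean_curvature S N (patch t f g (x, y)) = \<nu> x y * M x y / (2 * W x y)"
    and K: "gauss_curvature S N (patch t f g (x, y)) = (\<nu> x y)\<^sup>2 * (f2 x * g2 y) / W x y"
    and \<nu>: "(\<nu> x y)\<^sup>2 * W x y = 1" if "x \<in> I" "y \<in> J" for x y
    using curvature_patch[OF f(1,2) g(1,2) X N that] unfolding \<nu>_def M_def W_def by simp_all
  have wg: "a * (\<nu> x y * M x y / (2 * W x y)) + b * ((\<nu> x y)\<^sup>2 * (f2 x * g2 y) / W x y) = c"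
    if xy: "x \<in> I" "y \<in> J" for x y
  proof -
    have "patch t f g (x, y) \<in> S" using openin_imp_subset[OF S] xy by blast
    from weingarten[OF this] show ?thesis unfolding H[OF xy] K[OF xy] .
  qed
  have K0: "f2 x * g2 y = 0" if bc: "\<not> (b = 0 \<and> c = 0)" and xy: "x \<in> I" "y \<in> J" for x y
  proof -
    have NX: "continuous_on (I \<times> J) (\<lambda>z. N (patch t f g z))"
    proof (rule continuous_on_compose2[of S N])
      show "continuous_on S N" using N unfolding unit_normal_field_def by blast
      show "continuous_on (I \<times> J) (patch t f g)"
        using X unfolding local_parametrization_def homeomorphism_def by blast
      show "patch t f g ` (I \<times> J) \<subseteq> S" using openin_imp_subset[OF S] .
    qed
    \<comment> \<open>By \<nu> the factor \<open>N \<bullet> a3\<close> never vanishes, so on the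
      connected domain it has a constant sign \<epsilon> and equals
      \<open>\<epsilon> / sqrt W\<close>. The relation thereby acquires the constant coefficient
      \<open>a * \<epsilon> / 2\<close>.\<close>
    have "connected (I \<times> J)" using I J by (simp add: connected_Times is_interval_connected)
    moreover have "continuous_on (I \<times> J) (\<lambda>z. N (patch t f g z) \<bullet> a3)"
      by (intro continuous_on_inner NX continuous_on_const)
    moreover have "N (patch t f g z) \<bullet> a3 \<noteq> 0" if z: "z \<in> I \<times> J" for z
    proof -
      have "(\<nu> (fst z) (snd z))\<^sup>2 * W (fst z) (snd z) = 1" using \<nu> z by auto
      then show ?thesis unfolding \<nu>_def by auto
    qed
    ultimately have "\<exists>\<epsilon>::real. (\<epsilon> = 1 \<or> \<epsilon> = - 1) \<and> (\<forall>z\<in>I \<times> J. \<epsilon> * (N (patch t f g z) \<bullet> a3) > 0)"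
      by (rule continuous_nonzero_sign)
    then obtain \<epsilon> :: real where \<epsilon>: "\<epsilon> = 1 \<or> \<epsilon> = - 1"
        "\<And>z. z \<in> I \<times> J \<Longrightarrow> \<epsilon> * (N (patch t f g z) \<bullet> a3) > 0"
      by blast
    have eq: "a * \<epsilon> / 2 * sqrt (W x y) * M x y + b * f2 x * g2 y = c * (W x y)\<^sup>2"
      if xy: "x \<in> I" "y \<in> J" for x y
    proof -
      define w where "w = sqrt (W x y)"
      have w: "w > 0" "W x y = w\<^sup>2" using W[of x y] unfolding w_def by simp_all
      have "(\<epsilon> * \<nu> x y * w)\<^sup>2 = 1" using \<nu>[OF xy] \<epsilon>(1) w(2) by (auto simp: power_mult_distrib)
      moreover have "\<epsilon> * \<nu> x y * w > 0" using \<epsilon>(2)[of "(x, y)"] xy w(1) unfolding \<nu>_def by simp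
      ultimately have "\<epsilon> * \<nu> x y * w = 1" by (auto simp: power2_eq_1_iff)
      then have "\<nu> x y = \<epsilon> / w" using \<epsilon>(1) w(1) by (auto simp: field_simps)
      moreover have "\<epsilon>\<^sup>2 = 1" using \<epsilon>(1) by auto
      ultimately have "a * (\<epsilon> / w * M x y / (2 * w\<^sup>2)) + b * (1 / w\<^sup>2 * (f2 x * g2 y) / w\<^sup>2) = c"
        using wg[OF xy] unfolding w(2) by (simp add: power_divide)
      then have "c * w ^ 4 = (a * (\<epsilon> / w * M x y / (2 * w\<^sup>2)) + b * (1 / w\<^sup>2 * (f2 x * g2 y) / w\<^sup>2)) * w ^ 4"
        by simp
      also have "\<dots> = a * \<epsilon> / 2 * w * M x y + b * f2 x * g2 y"
        using w(1) by (simp add: field_simps power2_eq_square power4_eq_xxxx)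
      finally show ?thesis using w(1) unfolding w_def[symmetric] w(2) by simp
    qed
    show ?thesis
    proof (rule weingarten_dichotomy[OF I(1) J(1) f(2,3) g(2,3) _ bc _ xy])
      show "\<not> (a * \<epsilon> / 2 = 0 \<and> b = 0 \<and> c = 0)" using nz \<epsilon>(1) by auto
    qed (use eq in \<open>simp_all add: W_def M_def\<close>)
  qed
  obtain x0 y0 where xy0: "x0 \<in> I" "y0 \<in> J" "p = patch t f g (x0, y0)" using p by auto
  interpret swap: orthonormal_frame a2 a1 a3 by (rule swapped_frame)
  have S': "openin (top_of_set S) (swap.patch t g f ` (J \<times> I))" and p': "p \<in> swap.patch t g f ` (J \<times> I)"
    unfolding swapped_patch using S p by blast+
  have cyl_f: ?congruent if "\<And>x. x \<in> I \<Longrightarrow> f2 x = 0"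
  proof -
    have "\<exists>\<alpha> \<beta>. \<forall>x\<in>I. f x = \<alpha> * x + \<beta>"
      by (rule second_derivative_zero_imp_affine[OF conv(1) f(1)]) (use f(2) that in force)+
    then obtain \<alpha> \<beta> where "\<And>x. x \<in> I \<Longrightarrow> f x = \<alpha> * x + \<beta>" by blast
    from cylinder_patch[OF J fg(2) I(1) this S p] show ?congruent by blast
  qed
  have cyl_g: ?congruent if "\<And>y. y \<in> J \<Longrightarrow> g2 y = 0"
  proof -
    have "\<exists>\<alpha> \<beta>. \<forall>y\<in>J. g y = \<alpha> * y + \<beta>"
      by (rule second_derivative_zero_imp_affine[OF conv(2) g(1)]) (use g(2) that in force)+
    then obtain \<alpha> \<beta> where "\<And>y. y \<in> J \<Longrightarrow> g y = \<alpha> * y + \<beta>" by blast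
    from swap.cylinder_patch[OF I fg(1) J(1) this S' p'] show ?congruent by blast
  qed
  have "gauss_curvature S N p = 0" if "\<not> (b = 0 \<and> c = 0)"
    unfolding xy0(3) K[OF xy0(1,2)] K0[OF that xy0(1,2)] by simp
  moreover have ?congruent
  proof (cases "b = 0 \<and> c = 0")
    case False
    \<comment> \<open>As \<open>x\<close> and \<open>y\<close> vary independently, a point with
      \<open>f2 x\<close> nonzero forces \<open>g2\<close> to vanish on all of
      \<open>J\<close>.\<close>
    then show ?congruent using K0[OF False] cyl_f cyl_g by (metis mult_eq_0_iff)
  next
    case True
    have M0: "M x y = 0" if xy: "x \<in> I" "y \<in> J" for x y
      using wg[OF xy] \<nu>[OF xy] True nz W[of x y] by auto
    have pos: "1 + r\<^sup>2 > 0" for r :: real by (simp add: add_pos_nonneg)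
    \<comment> \<open>\<open>M = 0\<close> separates the variables: \<open>f2 / (1 + f1^2)\<close>
      and \<open>- g2 / (1 + g1^2)\<close> share one constant value, read off here at
      \<open>y0\<close>.\<close>
    define m where "m = - g2 y0 / (1 + (g1 y0)\<^sup>2)"
    have mf: "f2 x = m * (1 + (f1 x)\<^sup>2)" if "x \<in> I" for x
      using M0[OF that xy0(2)] pos[of "g1 y0"] unfolding M_def m_def by (simp add: field_simps)
    have mg: "g2 y = - m * (1 + (g1 y)\<^sup>2)" if "y \<in> J" for y
    proof -
      have "(g2 y + m * (1 + (g1 y)\<^sup>2)) * (1 + (f1 x0)\<^sup>2) = 0"
        using M0[OF xy0(1) that] mf[OF xy0(1)] unfolding M_def by (simp add: algebra_simps)
      then show ?thesis using pos[of "f1 x0"] by simp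
    qed
    consider "m = 0" | "m > 0" | "- m > 0" by linarith
    then show ?congruent
    proof cases
      case 1
      then show ?congruent using cyl_f mf by simp
    next
      case 2
      have "locally_congruent_at S p (scherk_surface m)"
        by (rule scherk_patch[OF I(1) conv(1) J(1) conv(2) 2 f(1) _ g(1) _ S p])
          (use f(2) g(2) mf mg in metis)+
      then show ?congruent using 2 by blast
    next
      case 3
      \<comment> \<open>Now \<open>g\<close> satisfies the equation with the positive constant
        \<open>- m\<close>, so the two variables change roles.\<close>
      have "locally_congruent_at S p (scherk_surface (- m))"
        by (rule swap.scherk_patch[OF J(1) conv(2) I(1) conv(1) 3 g(1) _ f(1) _ S' p'])
          (use f(2) g(2) mf mg in \<open>simp_all\<close>)
      then show ?congruent using 3 by blast
    qed
  qed
  ultimately show ?thesis by blast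
qed

end

section \<open>From patches to the whole surface\<close>

lemma columns_orthonormal_frame:
  assumes "orthogonal_matrix (A :: real^3^3)"
  shows "orthonormal_frame (column 1 A) (column 2 A) (column 3 A)"
proof -
  have "norm (column i A) = 1" "i \<noteq> j \<Longrightarrow> column i A \<bullet> column j A = 0" for i j
    using assms unfolding orthogonal_matrix_orthonormal_columns orthogonal_def by auto
  then show ?thesis by unfold_locales (simp_all add: dot_square_norm)
qed

lemma translation_patch_frame:
  assumes "orthogonal_matrix A"
  shows "translation_patch A t f g = orthonormal_frame.patch (column 1 A) (column 2 A) (column 3 A) t f g"
proof -
  interpret orthonormal_frame "column 1 A" "column 2 A" "column 3 A"
    by (rule columns_orthonormal_frame[OF assms])
  show ?thesis
    by (auto simp: fun_eq_iff translation_patch_def patch_def matrix_mult_sum sum_3 scalar_mult_eq_scaleR)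
qed

theorem theorem1:
  fixes S :: "(real^3) set" and N :: "real^3 \<Rightarrow> real^3"
  assumes "translation_surface S"
    and "unit_normal_field S N"
    and "linear_weingarten S N"
  shows "((\<exists>k. \<forall>p\<in>S. gauss_curvature S N p = k) \<or> (\<exists>h. \<forall>p\<in>S. mean_curvature S N p = h)) \<and>
    (\<forall>p\<in>S. \<exists>M. (is_plane M \<or> generalized_cylinder M \<or> (\<exists>l>0. M = scherk_surface l)) \<and>
       locally_congruent_at S p M)"
proof -
  obtain A t where A: "orthogonal_matrix A" and patches: "\<And>p. p \<in> S \<Longrightarrow> \<exists>I J f g.
      open I \<and> is_interval I \<and> open J \<and> is_interval J \<and> smooth_on I f \<and> smooth_on J g \<and>
      local_parametrization S (I \<times> J) (translation_patch A t f g) \<and>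
      p \<in> translation_patch A t f g ` (I \<times> J)"
    using assms(1) unfolding translation_surface_def by metis
  interpret orthonormal_frame "column 1 A" "column 2 A" "column 3 A"
    by (rule columns_orthonormal_frame[OF A])
  obtain a b c where nz: "\<not> (a = 0 \<and> b = 0 \<and> c = 0)"
    and weingarten: "\<And>p. p \<in> S \<Longrightarrow> a * mean_curvature S N p + b * gauss_curvature S N p = c"
    using assms(3) unfolding linear_weingarten_def by metis
  \<comment> \<open>The constants \<open>a\<close>, \<open>b\<close>, \<open>c\<close> are common to
    all patches, so the same alternative holds at every point, and the constant curvature is zero
    throughout \<open>S\<close>, even across different components.\<close>
  have local: "(\<not> (b = 0 \<and> c = 0) \<longrightarrow> gauss_curvature S N p = 0) \<and>
      (\<exists>M. (generalized_cylinder M \<or> (\<exists>l>0. M = scherk_surface l)) \<and> locally_congruent_at S p M)"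
    if p: "p \<in> S" for p
  proof -
    obtain I J f g where IJ: "open I" "is_interval I" "open J" "is_interval J" "smooth_on I f" "smooth_on J g"
      "local_parametrization S (I \<times> J) (patch t f g)" "p \<in> patch t f g ` (I \<times> J)"
      using patches[OF p] unfolding translation_patch_frame[OF A] by metis
    show ?thesis
      using weingarten_translation_patch[OF IJ(1-7) assms(2) nz weingarten IJ(8)] by blast
  qed
  have "(\<exists>k. \<forall>p\<in>S. gauss_curvature S N p = k) \<or> (\<exists>h. \<forall>p\<in>S. mean_curvature S N p = h)"
  proof (cases "b = 0 \<and> c = 0")
    case True
    then have "\<forall>p\<in>S. mean_curvature S N p = 0" using weingarten nz by simp
    then show ?thesis by blast
  next
    case False
    then show ?thesis using local by blast
  qed
  then show ?thesis using local by blast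
qed

end
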